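(* Let $\mathbb{F}$ be an algebraically closed field. Consider a nonconstant linear polynomial system matrix $$\mathcal{L}(\lambda) = \left[\begin{array}{c|cc} A(\lambda) & B(\lambda) & 0 \\ \hline -C(\lambda) & M(\lambda) & K_2(\lambda)^T \\ 0 & K_1(\lambda) & 0 \end{array}\right]\in\mathbb{F}[\lambda]^{(n+q)\times (n+r)}$$ with $n>0$ and (regular) state matrix $A(\lambda)\in\mathbb{F}[\lambda]^{n\times n}$. Let $$L(\lambda):=\begin{bmatrix} M(\lambda) & K_2(\lambda)^T \\ K_1(\lambda) & 0\end{bmatrix}$$ be a block full rank pencil, and let $N_1(\lambda)$ (resp. $N_2(\lambda)$) be any rational basis dual to $K_1(\lambda)$ (resp. $K_2(\lambda)$) with its row degrees all equal to an integer $t_1$ (resp. $t_2$). If $\operatorname{rev}_1 K_i(\lambda)$ and $\operatorname{rev}_{t_i}N_i(\lambda)$ have full row rank at zero for $i=1,2$ and $$\operatorname{rank}\begin{bmatrix}\operatorname{rev}_1 A(0)\\ -\operatorname{rev}_{t_2}N_2(0)\,\operatorname{rev}_1 C(0)\end{bmatrix}=\operatorname{rank}\begin{bmatrix}\operatorname{rev}_1 A(0) & \operatorname{rev}_1 B(0)\,\operatorname{rev}_{t_1}N_1(0)^T\end{bmatrix}=n,$$ then $\mathcal{L}(\lambda)$ is a linearization of the rational matrix $$R(\lambda)=N_2(\lambda)\,[\,M(\lambda)+C(\lambda)A(\lambda)^{-1}B(\lambda)\,]\,N_1(\lambda)^{T}$$ at $\infty$ of grade $1+t_1+t_2$ with state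 matrix $A(\lambda)$.
   Context: A pencil is a polynomial matrix of degree at most $1$ ("linear polynomial matrix"). A square rational matrix is regular if its determinant is not identically zero. For a rational matrix $G(\lambda)$ and an integer $g$, the $g$-reversal is $\operatorname{rev}_g G(\lambda):=\lambda^g G(1/\lambda)$, and $\operatorname{rev}_gG(0)$ denotes its value at $0$. For a scalar rational function $r(\lambda)=n(\lambda)/d(\lambda)$, $\deg r:=\deg n-\deg d$ (zero entries do not contribute to maxima of degrees, i.e. $\deg 0=-\infty$). The degree of a rational matrix is the maximum of the degrees of its entries. The row degrees of a rational matrix are the degrees of its rows. A rational matrix is defined at $\lambda_0\in\mathbb{F}$ if its entries (as irreducible fractions) have no pole at $\lambda_0$. A square rational matrix is invertible at $\lambda_0$ if it is defined at $\lambda_0$ and its determinant is nonzero there. A $p\times m$ rational matrix has full row rank at $\lambda_0$ if it is defined at $\lambda_0$ and its value there has rank $p$. Polynomial system matrix: a polynomial matrix $P(\lambda)=\begin{bmatrix}A(\lambda)&B(\lambda)\\ -C(\lambda)&D(\lambda)\end{bmatrix}$ with $A(\lambda)\in\mathbb{F}[\lambda]^{n\times n}$ regular (the state matrix); its transfer function matrix is $D(\lambda)+C(\lambda)A(\lambda)^{-1}B(\lambda)$. It is minimal at $\lambda_0$ if $\operatorname{rank}\begin{bmatrix}A(\lambda_0)\\ C(\lambda_0)\end{bmatrix}=\operatorname{rank}\begin{bmatrix}A(\lambda_0)&B(\lambda_0)\end{bmatrix}=n$. In the claim, the partition of $\mathcal{L}(\lambda)$ as a polynomial system matrix is the one indicated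 by the lines. Linearization at a point: a linear polynomial system matrix of size $(n+q)\times(n+r)$ with $n\times n$ state matrix and transfer function matrix $\widehat G(\lambda)\in\mathbb{F}(\lambda)^{q\times r}$ is a linearization of $G(\lambda)\in\mathbb{F}(\lambda)^{p\times m}$ at $\lambda_0$ if (a) it is minimal at $\lambda_0$, and (b) there exist nonnegative integers $s_1,s_2$ with $s_1-s_2=q-p=r-m$ and rational matrices $R_1(\lambda)\in\mathbb{F}(\lambda)^{(p+s_1)\times(p+s_1)}$, $R_2(\lambda)\in\mathbb{F}(\lambda)^{(m+s_1)\times(m+s_1)}$ invertible at $\lambda_0$ such that $R_1(\lambda)\operatorname{diag}(G(\lambda),I_{s_1})R_2(\lambda)=\operatorname{diag}(\widehat G(\lambda),I_{s_2})$. Linearization at infinity: a nonconstant linear polynomial system matrix $\mathcal{L}(\lambda)$ with state matrix $A(\lambda)$ is a linearization of $G(\lambda)$ at $\infty$ of grade $g$ (with state matrix $A(\lambda)$) if $\operatorname{rev}_1\mathcal{L}(\lambda)$, with state matrix $\operatorname{rev}_1A(\lambda)$, is a linearization of $\operatorname{rev}_gG(\lambda)$ at $0$. Block full rank pencil: a linear polynomial matrix of the form $\begin{bmatrix} M(\lambda)&K_2(\lambda)^T\\ K_1(\lambda)&0\end{bmatrix}$ where $K_1(\lambda)$ and $K_2(\lambda)$ are pencils with full row normal rank (i.e. full row rank over the field $\mathbb{F}(\lambda)$); $K_1$ or $K_2$ may be empty. A rational basis is a rational matrix with full row normal rank. Two rational matrices $G(\lambda)\in\mathbb{F}(\lambda)^{p\times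 m}$ and $H(\lambda)\in\mathbb{F}(\lambda)^{q\times m}$ are dual rational bases if both have full row normal rank, $p+q=m$ and $G(\lambda)H(\lambda)^T=0$. *)

theory Defs
  imports
    "Jordan_Normal_Form.DL_Rank"
    "Jordan_Normal_Form.Gauss_Jordan_Elimination"
    "HOL-Computational_Algebra.Computational_Algebra"
    "HOL-Library.Extended"
begin

section \<open>Rational functions\<close>

text \<open>Rational functions in \<open>\<lambda>\<close> over a field \<open>'a\<close> are elements of \<open>'a poly fract\<close>; a polynomial
  \<open>p\<close> is identified with \<open>to_fract p\<close>.  The irreducible representation below is unique up to a
  common nonzero constant factor, which none of the later notions depends on.  (The library's
  \<open>quot_of_fract\<close> is not used because it is not available over an arbitrary field.)\<close>

definition irreducible_fraction :: "'a::field poly fract \<Rightarrow> 'a poly \<times> 'a poly" where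
  "irreducible_fraction r = (SOME (n, d). coprime n d \<and> d \<noteq> 0 \<and> r = Fract n d)"

definition num :: "'a::field poly fract \<Rightarrow> 'a poly" where
  "num r = fst (irreducible_fraction r)"

definition den :: "'a::field poly fract \<Rightarrow> 'a poly" where
  "den r = snd (irreducible_fraction r)"

lemma irreducible_fraction_exists:
  fixes r :: "'a::field poly fract"
  shows "\<exists>n d. coprime n d \<and> d \<noteq> 0 \<and> r = Fract n d"
proof -
  define P where "P = (\<lambda>d::'a poly. d \<noteq> 0 \<and> (\<exists>n. r = Fract n d))"
  obtain n0 d0 where "r = Fract n0 d0" "d0 \<noteq> 0" by (cases r) auto
  then have "P d0" by (auto simp: P_def)
  then obtain d where d: "P d" "\<And>e. P e \<Longrightarrow> degree d \<le> degree e"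
    using ex_has_least_nat[of P d0 degree] by blast
  then obtain n where n: "d \<noteq> 0" "r = Fract n d" by (auto simp: P_def)
  have "coprime n d"
  proof (rule coprimeI)
    fix c assume "c dvd n" "c dvd d"
    then obtain n' d' where e: "n = c * n'" "d = c * d'" by (auto simp: dvd_def)
    with n have nz: "c \<noteq> 0" "d' \<noteq> 0" by auto
    have "r = Fract n' d'" using n e nz by (simp add: eq_fract)
    then have "degree d \<le> degree d'" using nz d(2) by (auto simp: P_def)
    then have "degree c = 0" using e nz by (simp add: degree_mult_eq)
    then show "is_unit c" using nz by (simp add: is_unit_iff_degree)
  qed
  with n show ?thesis by blast
qed

lemma num_den:
  fixes r :: "'a::field poly fract"
  shows "coprime (num r) (den r)" "den r \<noteq> 0" "r = Fract (num r) (den r)"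
proof -
  define Q where "Q = (\<lambda>z. case z of (n, d) \<Rightarrow> coprime n d \<and> d \<noteq> 0 \<and> r = Fract n d)"
  have "\<exists>z. Q z" using irreducible_fraction_exists[of r] by (auto simp: Q_def)
  then have "Q (irreducible_fraction r)"
    unfolding irreducible_fraction_def Q_def[symmetric] by (rule someI_ex)
  then show "coprime (num r) (den r)" "den r \<noteq> 0" "r = Fract (num r) (den r)"
    by (auto simp: Q_def num_def den_def case_prod_beta)
qed

lemma num_den_Fract:
  fixes n d :: "'a::field poly"
  assumes "d \<noteq> 0"
  obtains k where "k \<noteq> 0" "n = k * num (Fract n d)" "d = k * den (Fract n d)"
proof -
  define r where "r = Fract n d"
  define P where "P = (\<lambda>d::'a poly. d \<noteq> 0 \<and> (\<exists>n. r = Fract n d))"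
  have "P d" using assms by (auto simp: P_def r_def)
  then obtain g where g: "P g" "\<And>e. P e \<Longrightarrow> degree g \<le> degree e"
    using ex_has_least_nat[of P d degree] by blast
  then obtain m where m: "g \<noteq> 0" "r = Fract m g" by (auto simp: P_def)
  have *: "\<exists>q. a = q * m \<and> b = q * g" if b: "b \<noteq> 0" "r = Fract a b" for a b
  proof -
    define q where "q = b div g"
    have ab: "a * g = m * b" using b m by (simp add: eq_fract)
    have bq: "b mod g = b - q * g" by (simp add: q_def minus_div_mult_eq_mod)
    have "b mod g = 0"
    proof (rule ccontr)
      assume nz: "b mod g \<noteq> 0"
      have "(a - q * m) * g = a * g - q * m * g" by (rule left_diff_distrib)
      also have "\<dots> = m * (b mod g)"
        unfolding ab bq by (simp add: right_diff_distrib ac_simps)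
      finally have "r = Fract (a - q * m) (b mod g)"
        unfolding m(2) eq_fract(1)[OF m(1) nz] by (rule sym)
      then have "P (b mod g)" using nz by (auto simp: P_def)
      from g(2)[OF this] degree_mod_less'[OF m(1) nz] show False by simp
    qed
    then have "b = q * g" using bq by simp
    moreover have "a = q * m"
    proof -
      have "a * g = (q * m) * g" using ab \<open>b = q * g\<close> by (simp only: ac_simps)
      with m(1) show ?thesis by (simp only: mult_cancel_right) simp
    qed
    ultimately show ?thesis by blast
  qed
  from *[OF num_den(2,3)] obtain h where h: "num r = h * m" "den r = h * g" by blast
  from *[OF assms r_def] obtain q where q: "n = q * m" "d = q * g" by blast
  have "is_unit h" using num_den(1)[of r] h by (metis coprime_common_divisor dvd_triv_left)
  then obtain u where u: "h * u = 1" by (metis dvdE)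
  have "(q * u) * (h * y) = q * y" for y
    using arg_cong[OF u, of "\<lambda>z. q * z * y"] by (simp add: ac_simps)
  then have "n = (q * u) * num r" "d = (q * u) * den r"
    by (simp_all add: h q)
  moreover have "q * u \<noteq> 0"
  proof
    assume "q * u = 0"
    with \<open>d = (q * u) * den r\<close> have "d = 0" by (simp only: mult_zero_left)
    with assms show False by contradiction
  qed
  ultimately show thesis using that[of "q * u"] unfolding r_def by blast
qed

definition rat_defined_at :: "'a::field \<Rightarrow> 'a poly fract \<Rightarrow> bool" where
  "rat_defined_at x r \<longleftrightarrow> poly (den r) x \<noteq> 0"

text \<open>Only meaningful if \<open>rat_defined_at x r\<close>.\<close>
definition rat_value :: "'a::field \<Rightarrow> 'a poly fract \<Rightarrow> 'a" where
  "rat_value x r = poly (num r) x / poly (den r) x"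

text \<open>\<open>Minf\<close> stands for \<open>-\<infinity>\<close>.\<close>
definition rat_degree :: "'a::field poly fract \<Rightarrow> int extended" where
  "rat_degree r = (if r = 0 then Minf else Fin (int (degree (num r)) - int (degree (den r))))"

text \<open>The variable \<open>\<lambda>\<close>, and the value in the field of rational functions of a polynomial at a
  rational function.\<close>

definition var :: "'a::field poly fract" where
  "var = to_fract [:0, 1:]"

definition poly_subst :: "'a::field poly \<Rightarrow> 'a poly fract \<Rightarrow> 'a poly fract" where
  "poly_subst p z = poly (map_poly (\<lambda>c. to_fract [:c:]) p) z"

text \<open>\<open>\<lambda>\<^sup>g r(1/\<lambda>)\<close>\<close>
definition rat_rev :: "int \<Rightarrow> 'a::field poly fract \<Rightarrow> 'a poly fract" where
  "rat_rev g r = var powi g * (poly_subst (num r) (1 / var) / poly_subst (den r) (1 / var))"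

lemma rat_value_Fract:
  assumes "poly d x \<noteq> 0"
  shows "rat_defined_at x (Fract n d)" "rat_value x (Fract n d) = poly n x / poly d x"
proof -
  from assms have "d \<noteq> 0" by auto
  then obtain k where k: "n = k * num (Fract n d)" "d = k * den (Fract n d)"
    by (metis num_den_Fract)
  then have "poly n x = poly k x * poly (num (Fract n d)) x"
    "poly d x = poly k x * poly (den (Fract n d)) x"
    by (metis poly_mult)+
  with assms show "rat_defined_at x (Fract n d)" "rat_value x (Fract n d) = poly n x / poly d x"
    by (auto simp: rat_defined_at_def rat_value_def)
qed

lemma rat_degree_Fract:
  assumes "n \<noteq> 0" "d \<noteq> 0"
  shows "rat_degree (Fract n d) = Fin (int (degree n) - int (degree d))"
proof -
  obtain k where k: "k \<noteq> 0" "n = k * num (Fract n d)" "d = k * den (Fract n d)"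
    using assms(2) by (metis num_den_Fract)
  then have "degree n = degree k + degree (num (Fract n d))"
    "degree d = degree k + degree (den (Fract n d))"
    using assms by (metis degree_mult_eq mult_eq_0_iff)+
  moreover have "Fract n d \<noteq> 0" using assms by (simp add: Zero_fract_def eq_fract)
  ultimately show ?thesis by (simp add: rat_degree_def)
qed

lemma to_fract_const_sum:
  "to_fract [:\<Sum>i\<in>A. f i:] = (\<Sum>i\<in>A. to_fract [:f i :: 'a::field:])"
proof (induction A rule: infinite_finite_induct)
  case (insert x F)
  have "[:f x + sum f F:] = [:f x:] + [:sum f F:]" by simp
  then have "to_fract [:f x + sum f F:] = to_fract [:f x:] + to_fract [:sum f F:]"
    by (simp only: to_fract_add)
  with insert show ?case by simp
qed auto

lemma poly_subst_mult:
  fixes p q :: "'a::field poly"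
  shows "poly_subst (p * q) z = poly_subst p z * poly_subst q z"
proof -
  have c: "to_fract [:a:] * to_fract [:b:] = to_fract [:a * b::'a:]" for a b
    by (simp flip: to_fract_mult)
  have "map_poly (\<lambda>c. to_fract [:c:]) (p * q) =
      map_poly (\<lambda>c. to_fract [:c:]) p * map_poly (\<lambda>c. to_fract [:c:]) q"
    by (intro poly_eqI) (simp add: coeff_map_poly coeff_mult to_fract_const_sum c)
  then show ?thesis by (simp add: poly_subst_def)
qed

lemma rat_rev_linear: "rat_rev 1 (to_fract [:a, b:]) = to_fract [:b::'a::field, a:]"
proof -
  define r :: "'a poly fract" where "r = to_fract [:a, b:]"
  define x :: "'a poly fract" where "x = 1 / var"
  have r: "r = Fract [:a, b:] 1" by (simp add: r_def to_fract_def)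
  obtain k where k: "[:a, b:] = k * num r" "1 = k * den r"
    using num_den_Fract[of "1 :: 'a poly" "[:a, b:]"] unfolding r by (metis one_neq_zero)
  have v: "var \<noteq> (0 :: 'a poly fract)" by (simp add: var_def)
  have "to_fract [:1::'a:] = 1" by (simp only: one_pCons[symmetric] to_fract_1)
  then have one: "poly_subst 1 x = 1"
    by (simp add: poly_subst_def one_pCons map_poly_pCons del: pCons_one)
  have s: "poly_subst [:a, b:] x = poly_subst k x * poly_subst (num r) x"
    by (subst k(1)) (rule poly_subst_mult)
  have "poly_subst 1 x = poly_subst k x * poly_subst (den r) x"
    by (subst k(2)) (rule poly_subst_mult)
  with one have t: "poly_subst k x * poly_subst (den r) x = 1" by simp
  then have nz: "poly_subst k x \<noteq> 0" "poly_subst (den r) x \<noteq> 0" by auto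
  have "poly_subst (num r) x / poly_subst (den r) x =
      (poly_subst k x * poly_subst (num r) x) / (poly_subst k x * poly_subst (den r) x)"
    using nz by simp
  also have "\<dots> = poly_subst [:a, b:] x" by (simp only: s t div_by_1)
  also have "\<dots> = to_fract [:a:] + to_fract [:b:] / var"
    by (simp add: poly_subst_def map_poly_pCons x_def)
  finally have "rat_rev 1 r = var * (to_fract [:a:] + to_fract [:b:] / var)"
    by (simp add: rat_rev_def x_def)
  also have "\<dots> = var * to_fract [:a:] + to_fract [:b:]"
    using v by (simp add: distrib_left)
  also have "\<dots> = to_fract [:b, a:]"
    by (simp add: var_def flip: to_fract_mult to_fract_add)
  finally show ?thesis by (simp only: r_def)
qed


section \<open>Rational matrices\<close>

type_synonym 'a rmat = "'a poly fract mat"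

definition append_cols :: "'a::zero mat \<Rightarrow> 'a mat \<Rightarrow> 'a mat" where
  "append_cols A B = four_block_mat A B (0\<^sub>m 0 (dim_col A)) (0\<^sub>m 0 (dim_col B))"

text \<open>For rational matrices this is the normal rank, i.e. the rank over the field of rational
  functions.\<close>
definition mat_rank :: "'a::field mat \<Rightarrow> nat" where
  "mat_rank A = vec_space.rank (dim_row A) A"

definition full_row_normal_rank :: "'a::field rmat \<Rightarrow> bool" where
  "full_row_normal_rank G \<longleftrightarrow> mat_rank G = dim_row G"

definition polynomial_matrix :: "'a::field rmat \<Rightarrow> bool" where
  "polynomial_matrix G \<longleftrightarrow> elements_mat G \<subseteq> range to_fract"

definition pencil :: "'a::field rmat \<Rightarrow> bool" where
  "pencil G \<longleftrightarrow> elements_mat G \<subseteq> to_fract ` {p. degree p \<le> 1}"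

definition constant_matrix :: "'a::field rmat \<Rightarrow> bool" where
  "constant_matrix G \<longleftrightarrow> elements_mat G \<subseteq> to_fract ` {p. degree p = 0}"

definition regular :: "'a::field rmat \<Rightarrow> bool" where
  "regular G \<longleftrightarrow> square_mat G \<and> det G \<noteq> 0"

definition row_degree :: "'a::field rmat \<Rightarrow> nat \<Rightarrow> int extended" where
  "row_degree G i = Max (insert Minf {rat_degree (G $$ (i, j)) | j. j < dim_col G})"

definition mat_rev :: "int \<Rightarrow> 'a::field rmat \<Rightarrow> 'a rmat" where
  "mat_rev g G = map_mat (rat_rev g) G"

definition defined_at :: "'a::field \<Rightarrow> 'a rmat \<Rightarrow> bool" where
  "defined_at x G \<longleftrightarrow> (\<forall>r \<in> elements_mat G. rat_defined_at x r)"

text \<open>Only meaningful if \<open>defined_at x G\<close>.\<close>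
definition mat_value :: "'a::field \<Rightarrow> 'a rmat \<Rightarrow> 'a mat" where
  "mat_value x G = map_mat (rat_value x) G"

definition invertible_at :: "'a::field \<Rightarrow> 'a rmat \<Rightarrow> bool" where
  "invertible_at x G \<longleftrightarrow> square_mat G \<and> defined_at x G \<and> rat_value x (det G) \<noteq> 0"

definition full_row_rank_at :: "'a::field \<Rightarrow> 'a rmat \<Rightarrow> bool" where
  "full_row_rank_at x G \<longleftrightarrow> defined_at x G \<and> mat_rank (mat_value x G) = dim_row G"

definition rational_basis :: "'a::field rmat \<Rightarrow> bool" where
  "rational_basis G \<longleftrightarrow> full_row_normal_rank G"

definition dual_rational_bases :: "'a::field rmat \<Rightarrow> 'a rmat \<Rightarrow> bool" where
  "dual_rational_bases G H \<longleftrightarrow>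
     rational_basis G \<and> rational_basis H \<and>
     dim_col G = dim_col H \<and> dim_row G + dim_row H = dim_col G \<and>
     G * transpose_mat H = 0\<^sub>m (dim_row G) (dim_row H)"

text \<open>Blocks \<open>K1\<close>, \<open>K2\<close> with no rows are allowed.\<close>
definition block_full_rank_pencil :: "'a::field rmat \<Rightarrow> 'a rmat \<Rightarrow> 'a rmat \<Rightarrow> 'a rmat \<Rightarrow> bool" where
  "block_full_rank_pencil L M K1 K2 \<longleftrightarrow>
     dim_col K1 = dim_col M \<and> dim_col K2 = dim_row M \<and>
     L = four_block_mat M (transpose_mat K2) K1 (0\<^sub>m (dim_row K1) (dim_row K2)) \<and>
     pencil L \<and> full_row_normal_rank K1 \<and> full_row_normal_rank K2"


section \<open>Polynomial system matrices and linearizations\<close>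

definition polynomial_system_matrix ::
  "'a::field rmat \<Rightarrow> 'a rmat \<Rightarrow> 'a rmat \<Rightarrow> 'a rmat \<Rightarrow> 'a rmat \<Rightarrow> bool" where
  "polynomial_system_matrix P A B C D \<longleftrightarrow>
     dim_row B = dim_row A \<and> dim_col C = dim_col A \<and> dim_row C = dim_row D \<and> dim_col B = dim_col D \<and>
     P = four_block_mat A B (- C) D \<and> polynomial_matrix P \<and> regular A"

text \<open>The matrix inverse exists because state matrices are regular.\<close>
definition transfer_function :: "'a::field rmat \<Rightarrow> 'a rmat \<Rightarrow> 'a rmat \<Rightarrow> 'a rmat \<Rightarrow> 'a rmat" where
  "transfer_function A B C D = D + C * the (mat_inverse A) * B"

definition minimal_at :: "'a::field \<Rightarrow> 'a rmat \<Rightarrow> 'a rmat \<Rightarrow> 'a rmat \<Rightarrow> bool" where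
  "minimal_at x A B C \<longleftrightarrow>
     mat_rank (mat_value x A @\<^sub>r mat_value x C) = dim_row A \<and>
     mat_rank (append_cols (mat_value x A) (mat_value x B)) = dim_row A"

text \<open>In the next two definitions \<open>P\<close> is the system matrix and \<open>A\<close> its state matrix; the other
  blocks are determined by these two.\<close>

definition linearization_at :: "'a::field \<Rightarrow> 'a rmat \<Rightarrow> 'a rmat \<Rightarrow> 'a rmat \<Rightarrow> bool" where
  "linearization_at x G P A \<longleftrightarrow>
     pencil P \<and>
     (\<exists>B C D. polynomial_system_matrix P A B C D \<and> minimal_at x A B C \<and>
       (\<exists>s\<^sub>1 s\<^sub>2 :: nat. \<exists>R\<^sub>1 R\<^sub>2.
          int s\<^sub>1 - int s\<^sub>2 = int (dim_row D) - int (dim_row G) \<and>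
          int s\<^sub>1 - int s\<^sub>2 = int (dim_col D) - int (dim_col G) \<and>
          R\<^sub>1 \<in> carrier_mat (dim_row G + s\<^sub>1) (dim_row G + s\<^sub>1) \<and> invertible_at x R\<^sub>1 \<and>
          R\<^sub>2 \<in> carrier_mat (dim_col G + s\<^sub>1) (dim_col G + s\<^sub>1) \<and> invertible_at x R\<^sub>2 \<and>
          R\<^sub>1 * diag_block_mat [G, 1\<^sub>m s\<^sub>1] * R\<^sub>2 = diag_block_mat [transfer_function A B C D, 1\<^sub>m s\<^sub>2]))"

definition linearization_at_infinity :: "int \<Rightarrow> 'a::field rmat \<Rightarrow> 'a rmat \<Rightarrow> 'a rmat \<Rightarrow> bool" where
  "linearization_at_infinity g G P A \<longleftrightarrow>
     pencil P \<and> \<not> constant_matrix P \<and>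
     (\<exists>B C D. polynomial_system_matrix P A B C D) \<and>
     linearization_at 0 (mat_rev g G) (mat_rev 1 P) (mat_rev 1 A)"

end

theory Submission
  imports Defs
begin

text \<open>
  Reversal substitutes \<open>1/\<lambda>\<close> for \<open>\<lambda>\<close>, which is a field automorphism, and multiplies by a power of
  \<open>\<lambda>\<close>.  Hence it is additive, and multiplicative with grades that add up (\<open>mat_rev_mult\<close>), so that
  the reversal of \<open>N\<^sub>2 (M + C A\<^sup>-\<^sup>1 B) N\<^sub>1\<^sup>T\<close> of grade \<open>t\<^sub>2 + 1 + t\<^sub>1\<close> is the same expression in the
  reversed matrices: \<open>C\<close>, \<open>B\<close> have grade \<open>1\<close> and \<open>A\<^sup>-\<^sup>1\<close> has grade \<open>-1\<close>.  Therefore it suffices to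
  prove the analogous theorem at a finite point \<open>x\<close>, here \<open>linearization_at_block_full_rank\<close>, and to
  apply it to the reversed matrices at \<open>0\<close>.

  Let \<open>O\<close> be the local ring of the rational functions that are defined at \<open>x\<close>, and write
  \<open>T = C A\<^sup>-\<^sup>1 B\<close>, \<open>W = M + T\<close> and \<open>R = N\<^sub>2 W N\<^sub>1\<^sup>T\<close>.  The transfer function of the pencil is the
  block matrix with rows \<open>(W, K\<^sub>2\<^sup>T)\<close> and \<open>(K\<^sub>1, 0)\<close>, and it has to be shown equivalent to
  \<open>diag(R, I)\<close> by matrices that are invertible over \<open>O\<close>.  A matrix over \<open>O\<close> whose value at \<open>x\<close> has
  full row rank has a right inverse over \<open>O\<close>, by lifting one for its value and dividing by a
  determinant that is a unit (\<open>defined_at_right_inverse\<close>).  Together with duality this splits the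
  space on the left of \<open>W\<close> along \<open>N\<^sub>2\<close> and \<open>K\<^sub>2\<close>, and the one on the right along \<open>N\<^sub>1\<close> and \<open>K\<^sub>1\<close>.
  In coordinates of such a splitting \<open>K\<^sub>1\<close> and \<open>K\<^sub>2\<^sup>T\<close> become unit blocks that clear every entry of
  \<open>W\<close> over \<open>O\<close> outside of the block \<open>R\<close>.

  The difficulty is that \<open>W\<close> need not lie over \<open>O\<close>, because \<open>A\<close> may be singular at \<open>x\<close>.  This is
  where the two rank conditions enter.  Lifted to \<open>O\<close> they are the Bezout identities
  \<open>X A + V (N\<^sub>2 C) = I\<close> and \<open>A X' + (B N\<^sub>1\<^sup>T) V' = I\<close> (\<open>left_bezout_at\<close>, \<open>right_bezout_at\<close>), and
  multiplying the first one by \<open>C\<close> on the left and by \<open>A\<^sup>-\<^sup>1 B\<close> on the right gives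
  \<open>T = C X B + (C V) (N\<^sub>2 T)\<close>: up to a matrix over \<open>O\<close>, \<open>T\<close> is recovered from \<open>N\<^sub>2 T\<close>, and likewise
  from \<open>T N\<^sub>1\<^sup>T\<close>.  So all poles of \<open>W\<close> at \<open>x\<close> are visible in \<open>R\<close>, and the splittings can be
  chosen such that \<open>W - H\<^sub>2 R H\<^sub>1\<close> is defined at \<open>x\<close>, where \<open>N\<^sub>2 H\<^sub>2 = I\<close> and \<open>H\<^sub>1 N\<^sub>1\<^sup>T = I\<close>
  (\<open>splitting_with_defined_remainder\<close>).  That difference vanishes between \<open>N\<^sub>2\<close> and \<open>N\<^sub>1\<^sup>T\<close>, hence
  it is of the form \<open>K\<^sub>2\<^sup>T Q + P K\<^sub>1\<close> over \<open>O\<close>, which is what the elimination needs.  Minimality of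
  the pencil at \<open>x\<close> follows from the same rank conditions, as passing from \<open>C\<close> to \<open>N\<^sub>2 C\<close> cannot
  increase a rank.
\<close>

section \<open>Rank and one-sided inverses\<close>

lemma mat_rank_eq_dim_row_iff:
  fixes A :: "'a::field mat"
  assumes A: "A \<in> carrier_mat m n"
  shows "mat_rank A = m \<longleftrightarrow> (\<exists>X \<in> carrier_mat n m. A * X = 1\<^sub>m m)"
proof -
  interpret vec_space "TYPE('a)" m .
  have cols: "set (cols A) \<subseteq> carrier_vec m" using cols_dim[of A] A by auto
  have rk: "mat_rank A = vectorspace.dim class_ring (span_vs (set (cols A)))"
    using A by (simp add: mat_rank_def rank_def)
  have range: "span (set (cols A)) = {y \<in> carrier_vec m. \<exists>x\<in>carrier_vec n. A *\<^sub>v x = y}"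
    using col_space_eq[OF A] A by (simp add: col_space_def)
  show ?thesis
  proof
    assume full: "mat_rank A = m"
    obtain S where S: "maximal S (\<lambda>T. T \<subseteq> set (cols A) \<and> lin_indpt T)" "finite S"
      using maximal_exists_superset[of "set (cols A)" "\<lambda>T. T \<subseteq> set (cols A) \<and> lin_indpt T" "{}"]
        finite_lin_indpt2[of "{}"] by auto
    have "card S = m" using rank_card_indpt[OF A S(1)] full A by (simp add: mat_rank_def)
    moreover have sub: "S \<subseteq> set (cols A)" and li: "lin_indpt S" using S(1) by (auto simp: maximal_def)
    ultimately have "basis S" using dim_li_is_basis[OF fin_dim S(2) _ li] cols dim_is_n by auto
    then have "carrier_vec m \<subseteq> span (set (cols A))"
      using span_is_monotone[OF sub] by (auto simp: basis_def)
    then have "\<exists>x. x \<in> carrier_vec n \<and> A *\<^sub>v x = unit_vec m j" for j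
      using range unit_vec_carrier[of m j] by blast
    then obtain x where x: "\<And>j. x j \<in> carrier_vec n" "\<And>j. A *\<^sub>v x j = unit_vec m j" by metis
    define X where "X = mat_of_cols n (map x [0..<m])"
    have X: "X \<in> carrier_mat n m"
      using mat_of_cols_carrier(1)[of n "map x [0..<m]"] by (simp add: X_def)
    have "A * X = 1\<^sub>m m"
    proof (rule mat_col_eqI)
      fix j assume "j < dim_col (1\<^sub>m m)"
      then have j: "j < m" by simp
      have "col X j = x j" using j x(1) by (simp add: X_def col_mat_of_cols)
      then show "col (A * X) j = col (1\<^sub>m m) j"
        using col_mult2[OF A X j] x(2) j by (simp add: col_one)
    qed (use A X in auto)
    with X show "\<exists>X \<in> carrier_mat n m. A * X = 1\<^sub>m m" by blast
  next
    assume "\<exists>X \<in> carrier_mat n m. A * X = 1\<^sub>m m"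
    then obtain X where X: "X \<in> carrier_mat n m" "A * X = 1\<^sub>m m" by blast
    have "\<exists>x\<in>carrier_vec n. A *\<^sub>v x = y" if "y \<in> carrier_vec m" for y
      using that A X by (intro bexI[of _ "X *\<^sub>v y"]) (auto simp flip: assoc_mult_mat_vec)
    then have "span (set (cols A)) = carrier_vec m" using range by auto
    then have "span_vs (set (cols A)) = V" by simp
    then show "mat_rank A = m" using rk dim_is_n by simp
  qed
qed

text \<open>The columns of a matrix of full column rank extend to a basis by unit vectors.  The first rows of
the inverse of the resulting square matrix form a left inverse.\<close>
lemma mat_rank_eq_dim_col_iff:
  fixes A :: "'a::field mat"
  assumes A: "A \<in> carrier_mat m n"
  shows "mat_rank A = n \<longleftrightarrow> (\<exists>X \<in> carrier_mat n m. X * A = 1\<^sub>m n)"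
proof -
  interpret vec_space "TYPE('a)" m .
  have cols: "set (cols A) \<subseteq> carrier_vec m" using cols_dim[of A] A by auto
  show ?thesis
  proof
    assume full: "mat_rank A = n"
    then have rk: "rank A = n" using A by (simp add: mat_rank_def)
    obtain S where S: "maximal S (\<lambda>T. T \<subseteq> set (cols A) \<and> lin_indpt T)"
      using maximal_exists_superset[of "set (cols A)" "\<lambda>T. T \<subseteq> set (cols A) \<and> lin_indpt T" "{}"]
        finite_lin_indpt2[of "{}"] by auto
    have "card S = n" "S \<subseteq> set (cols A)"
      using rank_card_indpt[OF A S] rk S by (auto simp: maximal_def)
    then have "n \<le> card (set (cols A))" by (metis List.finite_set card_mono)
    then have dist: "distinct (cols A)"
      using A card_length[of "cols A"] by (intro card_distinct) auto
    have li: "lin_indpt (set (cols A))" by (rule full_rank_lin_indpt[OF A rk dist])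
    \<comment> \<open>Extend the columns of \<open>A\<close> to a maximal independent subset of \<open>G\<close>.\<close>
    define G where "G = set (cols A) \<union> set (unit_vecs m)"
    have G: "G \<subseteq> carrier_vec m" using cols unit_vecs_carrier by (auto simp: G_def)
    obtain U where U: "maximal U (\<lambda>T. T \<subseteq> G \<and> lin_indpt T)" "set (cols A) \<subseteq> U" "finite U"
      using maximal_exists_superset[of G "\<lambda>T. T \<subseteq> G \<and> lin_indpt T" "set (cols A)"] li
      by (auto simp: G_def)
    have "span (set (unit_vecs m)) = carrier_vec m"
      using unit_vecs_basis by (simp add: basis_def)
    then have "span G = carrier_vec m"
      using span_is_monotone[of "set (unit_vecs m)" G] span_is_subset2[OF G] by (auto simp: G_def)
    then have "span_vs G = V" by simp
    with dim_span[OF _ _ U(1)] G have cU: "card U = m"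
      using dim_is_n by (auto simp: G_def)
    obtain bs where bs: "set bs = U - set (cols A)" "distinct bs"
      using finite_distinct_list[of "U - set (cols A)"] U by auto
    define us where "us = cols A @ bs"
    have us: "set us = U" "distinct us" using bs dist U by (auto simp: us_def)
    then have len: "length us = m" using cU distinct_card by metis
    have usc: "set us \<subseteq> carrier_vec m" using us U(1) G by (auto simp: maximal_def)
    define Q where "Q = mat_of_cols m us"
    have Q: "Q \<in> carrier_mat m m" using mat_of_cols_carrier(1)[of m us] len by (simp add: Q_def)
    have cQ: "cols Q = us" using usc by (simp add: Q_def cols_mat_of_cols)
    have "rank Q = m"
      using lin_indpt_full_rank[OF Q] us cQ U(1) unfolding maximal_def by metis
    then have "mat_rank Q = m" using Q by (simp add: mat_rank_def)
    then obtain Y where Y: "Y \<in> carrier_mat m m" "Q * Y = 1\<^sub>m m"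
      using mat_rank_eq_dim_row_iff[OF Q] by blast
    then have YQ: "Y * Q = 1\<^sub>m m" using mat_mult_left_right_inverse[OF Q] by blast
    have nm: "n \<le> m" using len A by (simp add: us_def)
    define X where "X = mat n m (\<lambda>(i, j). Y $$ (i, j))"
    have "X * A = 1\<^sub>m n"
    proof (rule eq_matI)
      fix i j assume ij: "i < dim_row (1\<^sub>m n)" "j < dim_col (1\<^sub>m n)"
      have "col A j = cols Q ! j" using ij A by (simp add: cQ us_def nth_append)
      also have "\<dots> = col Q j" using ij nm Q by simp
      finally have c: "col A j = col Q j" .
      have r: "row X i = row Y i" using ij nm Y by (intro eq_vecI) (auto simp: X_def)
      have "(X * A) $$ (i, j) = (Y * Q) $$ (i, j)"
        using ij nm A Y Q c r by (simp add: X_def)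
      then show "(X * A) $$ (i, j) = 1\<^sub>m n $$ (i, j)" using ij nm YQ by simp
    qed (use A in \<open>auto simp: X_def\<close>)
    then show "\<exists>X \<in> carrier_mat n m. X * A = 1\<^sub>m n" by (intro bexI[of _ X]) (auto simp: X_def)
  next
    assume "\<exists>X \<in> carrier_mat n m. X * A = 1\<^sub>m n"
    then obtain X where X: "X \<in> carrier_mat n m" "X * A = 1\<^sub>m n" by blast
    have XAv: "X *\<^sub>v (A *\<^sub>v v) = v" if "v \<in> carrier_vec n" for v
      using that assoc_mult_mat_vec[OF X(1) A that] X(2) by simp
    have inj: "v = w" if "A *\<^sub>v v = A *\<^sub>v w" "v \<in> carrier_vec n" "w \<in> carrier_vec n" for v w
      using XAv[OF that(2)] XAv[OF that(3)] unfolding that(1) by (rule trans[OF sym])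
    have "distinct (cols A)"
    proof (unfold distinct_conv_nth, intro allI impI)
      fix i j assume ij: "i < length (cols A)" "j < length (cols A)" "i \<noteq> j"
      have c: "A *\<^sub>v unit_vec n k = col A k" if "k < n" for k
        using that A by (intro eq_vecI) auto
      have "unit_vec n i \<noteq> (unit_vec n j :: 'a vec)"
        using ij A by (metis carrier_matD(2) cols_length index_unit_vec(1) zero_neq_one)
      then show "cols A ! i \<noteq> cols A ! j"
        using ij A c[of i] c[of j] inj[of "unit_vec n i" "unit_vec n j"] by auto
    qed
    moreover have "lin_indpt (set (cols A))"
    proof
      assume "lin_dep (set (cols A))"
      then obtain v where v: "v \<in> carrier_vec n" "v \<noteq> 0\<^sub>v n" "A *\<^sub>v v = 0\<^sub>v m"
        using lin_depE[OF A _ calculation] by blast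
      moreover have "A *\<^sub>v 0\<^sub>v n = 0\<^sub>v m" using A by (intro eq_vecI) auto
      ultimately show False using inj[of v "0\<^sub>v n"] by auto
    qed
    ultimately show "mat_rank A = n"
      using lin_indpt_full_rank[OF A] A by (simp add: mat_rank_def)
  qed
qed

section \<open>Rational functions defined at a point\<close>

text \<open>Any denominator that does not vanish at the point witnesses definedness, which makes closure under
the ring operations a matter of calculating with fractions.\<close>
lemma rat_defined_at_iff:
  "rat_defined_at x r \<longleftrightarrow> (\<exists>n d. r = Fract n d \<and> poly d x \<noteq> 0)"
  using num_den(3)[of r] rat_value_Fract(1) by (metis rat_defined_at_def)

lemma rat_at_Fract_cases:
  assumes "rat_defined_at x r"
  obtains n d where "r = Fract n d" "d \<noteq> 0" "poly d x \<noteq> 0" "rat_value x r = poly n x / poly d x"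
  using assms rat_value_Fract(2) by (metis poly_0 rat_defined_at_iff)

lemma rat_at_poly [simp]:
  "rat_defined_at x (to_fract p)" "rat_value x (to_fract p) = poly p x"
  using rat_value_Fract[of 1 x p] by (simp_all add: to_fract_def)

lemma rat_at_0 [simp]: "rat_defined_at x 0" "rat_value x 0 = 0"
  using rat_at_poly[of x 0] by simp_all

lemma rat_at_1 [simp]: "rat_defined_at x 1" "rat_value x 1 = 1"
  using rat_at_poly[of x 1] by (simp_all del: rat_at_poly)

lemma rat_at_add:
  assumes "rat_defined_at x r" "rat_defined_at x s"
  shows "rat_defined_at x (r + s)" "rat_value x (r + s) = rat_value x r + rat_value x s"
proof -
  obtain n d where r: "r = Fract n d" "d \<noteq> 0" "poly d x \<noteq> 0" "rat_value x r = poly n x / poly d x"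
    using assms(1) by (rule rat_at_Fract_cases)
  obtain m e where s: "s = Fract m e" "e \<noteq> 0" "poly e x \<noteq> 0" "rat_value x s = poly m x / poly e x"
    using assms(2) by (rule rat_at_Fract_cases)
  have "r + s = Fract (n * e + m * d) (d * e)" using r s by simp
  then show "rat_defined_at x (r + s)" "rat_value x (r + s) = rat_value x r + rat_value x s"
    using rat_value_Fract[of "d * e" x "n * e + m * d"] r(3) s(3)
    by (simp_all add: r(4) s(4) add_frac_eq)
qed

lemma rat_at_mult:
  assumes "rat_defined_at x r" "rat_defined_at x s"
  shows "rat_defined_at x (r * s)" "rat_value x (r * s) = rat_value x r * rat_value x s"
proof -
  obtain n d where r: "r = Fract n d" "d \<noteq> 0" "poly d x \<noteq> 0" "rat_value x r = poly n x / poly d x"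
    using assms(1) by (rule rat_at_Fract_cases)
  obtain m e where s: "s = Fract m e" "e \<noteq> 0" "poly e x \<noteq> 0" "rat_value x s = poly m x / poly e x"
    using assms(2) by (rule rat_at_Fract_cases)
  have "r * s = Fract (n * m) (d * e)" using r s by simp
  then show "rat_defined_at x (r * s)" "rat_value x (r * s) = rat_value x r * rat_value x s"
    using rat_value_Fract[of "d * e" x "n * m"] r(3) s(3) by (simp_all add: r(4) s(4))
qed

lemma rat_at_uminus:
  assumes "rat_defined_at x r"
  shows "rat_defined_at x (- r)" "rat_value x (- r) = - rat_value x r"
  using rat_at_mult[OF rat_at_poly(1)[of x "- 1"] assms] rat_at_poly(2)[of x "- 1"]
  by (simp_all add: to_fract_uminus del: rat_at_poly)

lemma rat_defined_at_inverse:
  assumes "rat_defined_at x r" "rat_value x r \<noteq> 0"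
  shows "rat_defined_at x (inverse r)"
proof -
  obtain n d where r: "r = Fract n d" "d \<noteq> 0" "poly d x \<noteq> 0" "rat_value x r = poly n x / poly d x"
    using assms(1) by (rule rat_at_Fract_cases)
  with assms(2) have "poly n x \<noteq> 0" by auto
  then show ?thesis using r rat_value_Fract(1) by simp
qed

lemma rat_at_sum:
  assumes "\<And>i. i \<in> I \<Longrightarrow> rat_defined_at x (f i)"
  shows "rat_defined_at x (sum f I) \<and> rat_value x (sum f I) = (\<Sum>i\<in>I. rat_value x (f i))"
  using assms by (induction I rule: infinite_finite_induct) (auto simp: rat_at_add)

lemma rat_at_prod:
  assumes "\<And>i. i \<in> I \<Longrightarrow> rat_defined_at x (f i)"
  shows "rat_defined_at x (prod f I) \<and> rat_value x (prod f I) = (\<Prod>i\<in>I. rat_value x (f i))"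
  using assms by (induction I rule: infinite_finite_induct) (auto simp: rat_at_mult)

lemma rat_at_signof [simp]:
  "rat_defined_at x (of_int (sign p))" "rat_value x (of_int (sign p)) = of_int (sign p)"
  using rat_at_uminus[of x 1] by (auto simp: sign_def)

section \<open>Rational matrices defined at a point\<close>

lemma defined_at_iff:
  "defined_at x G \<longleftrightarrow> (\<forall>i < dim_row G. \<forall>j < dim_col G. rat_defined_at x (G $$ (i, j)))"
  by (auto simp: defined_at_def elements_mat_def)

lemma defined_atI:
  assumes "\<And>i j. i < dim_row G \<Longrightarrow> j < dim_col G \<Longrightarrow> rat_defined_at x (G $$ (i, j))"
  shows "defined_at x G"
  using assms by (simp add: defined_at_iff)

lemma defined_atD:
  "defined_at x G \<Longrightarrow> i < dim_row G \<Longrightarrow> j < dim_col G \<Longrightarrow> rat_defined_at x (G $$ (i, j))"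
  by (simp add: defined_at_iff)

lemma defined_at_pencil: "pencil G \<Longrightarrow> defined_at x G"
  by (auto simp: pencil_def defined_at_def)

lemma defined_at_one [simp]: "defined_at x (1\<^sub>m n)"
  by (auto intro!: defined_atI)

lemma defined_at_zero [simp]: "defined_at x (0\<^sub>m m n)"
  by (auto intro!: defined_atI)

lemma defined_at_transpose [simp]: "defined_at x (transpose_mat G) \<longleftrightarrow> defined_at x G"
  by (auto simp: defined_at_iff)

lemma defined_at_uminus: "defined_at x G \<Longrightarrow> defined_at x (- G)"
  by (auto intro!: defined_atI rat_at_uminus simp: defined_atD)

lemma defined_at_add:
  assumes "defined_at x G" "defined_at x H" "G \<in> carrier_mat m n" "H \<in> carrier_mat m n"
  shows "defined_at x (G + H)"
  using assms by (intro defined_atI) (auto simp: defined_atD intro!: rat_at_add)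

lemma defined_at_minus:
  assumes "defined_at x G" "defined_at x H" "G \<in> carrier_mat m n" "H \<in> carrier_mat m n"
  shows "defined_at x (G - H)"
  using defined_at_add[OF assms(1) defined_at_uminus[OF assms(2)]] assms
  by (simp add: minus_add_uminus_mat)

lemma mat_at_mult:
  assumes "defined_at x G" "defined_at x H" "G \<in> carrier_mat m n" "H \<in> carrier_mat n l"
  shows "defined_at x (G * H)" "mat_value x (G * H) = mat_value x G * mat_value x H"
proof -
  have e: "rat_defined_at x (\<Sum>k<n. G $$ (i, k) * H $$ (k, j)) \<and>
    rat_value x (\<Sum>k<n. G $$ (i, k) * H $$ (k, j)) = (\<Sum>k<n. rat_value x (G $$ (i, k)) * rat_value x (H $$ (k, j)))"
    if "i < m" "j < l" for i j
    using that assms rat_at_sum[of "{..<n}" x "\<lambda>k. G $$ (i, k) * H $$ (k, j)"]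
    by (auto simp: defined_atD rat_at_mult)
  show "defined_at x (G * H)"
    using assms(3,4) e by (intro defined_atI) (auto simp: scalar_prod_def atLeast0LessThan)
  show "mat_value x (G * H) = mat_value x G * mat_value x H"
    using assms(3,4) e
    by (intro eq_matI) (auto simp: mat_value_def scalar_prod_def atLeast0LessThan)
qed

lemma mat_value_carrier [simp]: "mat_value x G \<in> carrier_mat m n \<longleftrightarrow> G \<in> carrier_mat m n"
  by (simp add: mat_value_def)

lemma mat_value_zero [simp]: "mat_value x (0\<^sub>m m n) = 0\<^sub>m m n"
  by (intro eq_matI) (auto simp: mat_value_def)

lemma mat_value_transpose [simp]: "mat_value x (transpose_mat G) = transpose_mat (mat_value x G)"
  by (intro eq_matI) (auto simp: mat_value_def)

lemma mat_value_uminus: "defined_at x G \<Longrightarrow> mat_value x (- G) = - mat_value x G"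
  by (intro eq_matI) (auto simp: mat_value_def rat_at_uminus defined_atD)

lemma defined_at_four_block:
  assumes "defined_at x G" "defined_at x H" "defined_at x J" "defined_at x K"
    "G \<in> carrier_mat m n" "H \<in> carrier_mat m k" "J \<in> carrier_mat l n" "K \<in> carrier_mat l k"
  shows "defined_at x (four_block_mat G H J K)"
  using assms by (intro defined_atI) (auto simp: defined_atD)

lemma defined_at_append_cols:
  assumes "defined_at x G" "defined_at x H" "G \<in> carrier_mat m n" "H \<in> carrier_mat m k"
  shows "defined_at x (append_cols G H)"
  unfolding append_cols_def using assms by (auto intro!: defined_at_four_block)

lemma defined_at_append_rows:
  assumes "defined_at x G" "defined_at x H" "G \<in> carrier_mat m n" "H \<in> carrier_mat k n"
  shows "defined_at x (G @\<^sub>r H)"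
  unfolding append_rows_def using assms by (auto intro!: defined_at_four_block)

lemma defined_at_four_blockD:
  assumes d: "defined_at x (four_block_mat G H J K)"
    and c: "G \<in> carrier_mat m n" "H \<in> carrier_mat m k" "J \<in> carrier_mat l n" "K \<in> carrier_mat l k"
  shows "defined_at x G" "defined_at x H" "defined_at x J" "defined_at x K"
proof -
  have e: "rat_defined_at x (four_block_mat G H J K $$ (i, j))" if "i < m + l" "j < n + k" for i j
    using d that c by (auto simp: defined_at_iff)
  show "defined_at x G"
  proof (rule defined_atI)
    fix i j assume "i < dim_row G" "j < dim_col G"
    then show "rat_defined_at x (G $$ (i, j))" using e[of i j] c by simp
  qed
  show "defined_at x H"
  proof (rule defined_atI)
    fix i j assume "i < dim_row H" "j < dim_col H"
    then show "rat_defined_at x (H $$ (i, j))" using e[of i "n + j"] c by simp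
  qed
  show "defined_at x J"
  proof (rule defined_atI)
    fix i j assume "i < dim_row J" "j < dim_col J"
    then show "rat_defined_at x (J $$ (i, j))" using e[of "m + i" j] c by simp
  qed
  show "defined_at x K"
  proof (rule defined_atI)
    fix i j assume "i < dim_row K" "j < dim_col K"
    then show "rat_defined_at x (K $$ (i, j))" using e[of "m + i" "n + j"] c by simp
  qed
qed

lemma defined_at_append_colsD:
  assumes "defined_at x (append_cols G H)" "G \<in> carrier_mat m n" "H \<in> carrier_mat m k"
  shows "defined_at x G" "defined_at x H"
proof -
  have "defined_at x (four_block_mat G H (0\<^sub>m 0 n) (0\<^sub>m 0 k))"
    using assms by (simp add: append_cols_def)
  from defined_at_four_blockD(1,2)[OF this assms(2,3) zero_carrier_mat zero_carrier_mat]
  show "defined_at x G" "defined_at x H" .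
qed

lemma defined_at_append_rowsD:
  assumes "defined_at x (G @\<^sub>r H)" "G \<in> carrier_mat m n" "H \<in> carrier_mat k n"
  shows "defined_at x G" "defined_at x H"
proof -
  have "defined_at x (four_block_mat G (0\<^sub>m m 0) H (0\<^sub>m k 0))"
    using assms by (simp add: append_rows_def)
  from defined_at_four_blockD(1,3)[OF this assms(2) zero_carrier_mat assms(3) zero_carrier_mat]
  show "defined_at x G" "defined_at x H" .
qed

lemma mat_value_append_cols:
  assumes "G \<in> carrier_mat m n" "H \<in> carrier_mat m k"
  shows "mat_value x (append_cols G H) = append_cols (mat_value x G) (mat_value x H)"
  using assms by (intro eq_matI) (auto simp: append_cols_def mat_value_def)

lemma mat_value_append_rows:
  assumes "G \<in> carrier_mat m n" "H \<in> carrier_mat k n"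
  shows "mat_value x (G @\<^sub>r H) = mat_value x G @\<^sub>r mat_value x H"
  using assms by (intro eq_matI) (auto simp: append_rows_def mat_value_def)

section \<open>Inverses over the local ring of a point\<close>

lemma rat_at_det:
  assumes G: "G \<in> carrier_mat n n" and d: "defined_at x G"
  shows "rat_defined_at x (det G) \<and> rat_value x (det G) = det (mat_value x G)"
proof -
  have V: "mat_value x G \<in> carrier_mat n n" using G by (simp add: mat_value_def)
  have p: "rat_defined_at x (\<Prod>i = 0..<n. G $$ (i, p i)) \<and>
    rat_value x (\<Prod>i = 0..<n. G $$ (i, p i)) = (\<Prod>i = 0..<n. mat_value x G $$ (i, p i))"
    if "p permutes {0..<n}" for p
  proof -
    have "p i < n" if "i < n" for i using \<open>p permutes {0..<n}\<close> that permutes_in_image by fastforce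
    then show ?thesis
      using rat_at_prod[of "{0..<n}" x "\<lambda>i. G $$ (i, p i)"] G d
      by (auto simp: defined_atD mat_value_def)
  qed
  then show ?thesis
    unfolding det_def'[OF G] det_def'[OF V]
    using rat_at_sum[of "{p. p permutes {0..<n}}" x "\<lambda>p. signof p * (\<Prod>i = 0..<n. G $$ (i, p i))"]
    by (simp add: rat_at_mult)
qed

text \<open>Invertibility at a point will always be established by exhibiting an inverse that is defined there:
the determinants multiply to \<open>1\<close> and both have a value.\<close>
lemma invertible_at_if_inverse:
  assumes G: "G \<in> carrier_mat n n" "defined_at x G"
    and H: "H \<in> carrier_mat n n" "defined_at x H" and inv: "G * H = 1\<^sub>m n"
  shows "invertible_at x G" "invertible_at x H"
proof -
  have "rat_value x (det G) * rat_value x (det H) = 1"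
    using rat_at_det[OF G] rat_at_det[OF H] rat_at_mult(2) det_mult[OF G(1) H(1)] inv
    by (metis det_one rat_at_1(2))
  then show "invertible_at x G" "invertible_at x H" using G H by (auto simp: invertible_at_def)
qed

text \<open>Let \<open>T\<close> be a right inverse of the value of \<open>G\<close>, regarded as a constant matrix.  Then \<open>G T\<close> has the
identity as its value, so its determinant is a unit of the local ring, and its inverse, the adjugate
divided by the determinant, is again defined at the point.\<close>
lemma defined_at_right_inverse:
  assumes G: "G \<in> carrier_mat m n" and d: "defined_at x G"
    and X: "X \<in> carrier_mat n m" and inv: "mat_value x G * X = 1\<^sub>m m"
  obtains S where "S \<in> carrier_mat n m" "defined_at x S" "G * S = 1\<^sub>m m"
proof -
  define T where "T = map_mat (\<lambda>c. to_fract [:c:]) X"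
  have T: "T \<in> carrier_mat n m" "defined_at x T" "mat_value x T = X"
    using X by (auto simp: T_def mat_value_def intro!: defined_atI eq_matI)
  have D: "G * T \<in> carrier_mat m m" "defined_at x (G * T)" "mat_value x (G * T) = 1\<^sub>m m"
    using G d T inv by (auto simp: mat_at_mult)
  define r where "r = inverse (det (G * T))"
  have "rat_value x (det (G * T)) = 1" "rat_defined_at x (det (G * T))"
    using rat_at_det[OF D(1,2)] D(3) by simp_all
  then have r: "rat_defined_at x r" "det (G * T) \<noteq> 0"
    by (auto simp: r_def intro!: rat_defined_at_inverse)
  have cof: "rat_defined_at x (cofactor (G * T) i j)" if "i < m" "j < m" for i j
  proof -
    have "defined_at x (mat_delete (G * T) i j)"
      using that D(1,2) unfolding mat_delete_def by (intro defined_atI) (auto simp: defined_at_iff simp del: index_mult_mat(1))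
    then have "rat_defined_at x (det (mat_delete (G * T) i j))"
      using rat_at_det[OF mat_delete_carrier[OF D(1)]] by blast
    moreover have "rat_defined_at x ((- 1) ^ k)" for k
      by (induction k) (auto simp: rat_at_mult rat_at_uminus)
    ultimately show ?thesis unfolding cofactor_def by (auto intro!: rat_at_mult)
  qed
  define S where "S = T * (r \<cdot>\<^sub>m adj_mat (G * T))"
  note adj = adj_mat[OF D(1)]
  have "defined_at x (r \<cdot>\<^sub>m adj_mat (G * T))"
    using G T(1) cof r(1) by (intro defined_atI) (auto simp: adj_mat_def intro!: rat_at_mult)
  then have "defined_at x S" using T adj unfolding S_def by (intro mat_at_mult(1)[of _ _ _ n m m]) auto
  moreover have "G * S = 1\<^sub>m m"
  proof -
    have "G * S = (G * T) * (r \<cdot>\<^sub>m adj_mat (G * T))"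
      using G T adj(1) by (simp add: S_def assoc_mult_mat[of _ m n _ m _ m])
    also have "\<dots> = r \<cdot>\<^sub>m (det (G * T) \<cdot>\<^sub>m 1\<^sub>m m)"
      using adj D(1) by (simp add: mult_smult_distrib[of _ m m _ m])
    also have "\<dots> = 1\<^sub>m m" using r(2) by (intro eq_matI) (auto simp: r_def)
    finally show ?thesis .
  qed
  moreover have "S \<in> carrier_mat n m" using T adj by (simp add: S_def)
  ultimately show thesis using that by blast
qed

lemma defined_at_left_inverse:
  assumes G: "G \<in> carrier_mat m n" and d: "defined_at x G"
    and X: "X \<in> carrier_mat n m" and inv: "X * mat_value x G = 1\<^sub>m n"
  obtains S where "S \<in> carrier_mat n m" "defined_at x S" "S * G = 1\<^sub>m n"
proof -
  have V: "mat_value x G \<in> carrier_mat m n" using G by (simp add: mat_value_def)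
  have "mat_value x (transpose_mat G) * transpose_mat X = 1\<^sub>m n"
    using transpose_mult[OF X V] inv by simp
  then obtain S where S: "S \<in> carrier_mat m n" "defined_at x S" "transpose_mat G * S = 1\<^sub>m n"
    using defined_at_right_inverse[of "transpose_mat G" n m x "transpose_mat X"] G d X by auto
  have "transpose_mat S * G = 1\<^sub>m n"
    using transpose_mult[of "transpose_mat G" n m S n] S G by simp
  then show thesis using that[of "transpose_mat S"] S by simp
qed

lemma full_row_rank_at_right_inverse:
  assumes full: "full_row_rank_at x G" and G: "G \<in> carrier_mat m n"
  obtains S where "S \<in> carrier_mat n m" "defined_at x S" "G * S = 1\<^sub>m m"
proof -
  have "mat_value x G \<in> carrier_mat m n" using G by (simp add: mat_value_def)
  from mat_rank_eq_dim_row_iff[OF this]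
  obtain X where "X \<in> carrier_mat n m" "mat_value x G * X = 1\<^sub>m m"
    using full G by (auto simp: full_row_rank_at_def)
  from defined_at_right_inverse[OF G _ this] show thesis
    using full that by (auto simp: full_row_rank_at_def)
qed

section \<open>Calculating with matrices and blocks\<close>

text \<open>The ring laws below are phrased through \<^const>\<open>dim_row\<close> and \<^const>\<open>dim_col\<close> instead of carriers:
then every variable of a premise occurs in the left-hand side, and the laws are conditional rewrite
rules that normalize expressions in rectangular matrices.\<close>
lemma mat_assoc:
  "dim_col A = dim_row B \<Longrightarrow> dim_col B = dim_row C \<Longrightarrow> A * B * C = A * (B * (C :: 'a::comm_ring_1 mat))"
  by (rule assoc_mult_mat[of _ "dim_row A" "dim_col A" _ "dim_col B" _ "dim_col C"]) auto

lemma mat_distrib_left: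
  "dim_col A = dim_row B \<Longrightarrow> dim_row B = dim_row C \<Longrightarrow> dim_col B = dim_col C \<Longrightarrow>
    A * (B + C) = A * B + A * (C :: 'a::comm_ring_1 mat)"
  by (rule mult_add_distrib_mat[of _ "dim_row A" "dim_col A" _ "dim_col B"]) auto

lemma mat_distrib_right:
  "dim_row A = dim_row B \<Longrightarrow> dim_col A = dim_col B \<Longrightarrow> dim_col A = dim_row C \<Longrightarrow>
    (A + B) * C = A * C + B * (C :: 'a::comm_ring_1 mat)"
  by (rule add_mult_distrib_mat[of _ "dim_row A" "dim_col A" _ _ "dim_col C"]) auto

lemma mat_diff:
  "dim_row A = dim_row B \<Longrightarrow> dim_col A = dim_col B \<Longrightarrow> A - B = A + - (B :: 'a::comm_ring_1 mat)"
  by (intro eq_matI) auto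

lemma mat_uminus_add:
  "dim_row A = dim_row B \<Longrightarrow> dim_col A = dim_col B \<Longrightarrow> - (A + B) = - A + - (B :: 'a::comm_ring_1 mat)"
  by (intro eq_matI) auto

lemma mat_add_assoc:
  "dim_row A = dim_row B \<Longrightarrow> dim_col A = dim_col B \<Longrightarrow> dim_row B = dim_row C \<Longrightarrow> dim_col B = dim_col C \<Longrightarrow>
    A + B + C = A + (B + (C :: 'a::comm_ring_1 mat))"
  by (intro eq_matI) auto

lemma mat_add_commute:
  "dim_row A = dim_row B \<Longrightarrow> dim_col A = dim_col B \<Longrightarrow> A + B = B + (A :: 'a::comm_ring_1 mat)"
  by (intro eq_matI) auto

lemma mat_add_left_commute:
  "dim_row A = dim_row B \<Longrightarrow> dim_col A = dim_col B \<Longrightarrow> dim_row B = dim_row C \<Longrightarrow> dim_col B = dim_col C \<Longrightarrow>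
    A + (B + C) = B + (A + (C :: 'a::comm_ring_1 mat))"
  by (intro eq_matI) auto

lemma mat_cancel:
  "A + - (A :: 'a::comm_ring_1 mat) = 0\<^sub>m (dim_row A) (dim_col A)"
  "- A + A = 0\<^sub>m (dim_row A) (dim_col A)"
  "dim_row A = dim_row B \<Longrightarrow> dim_col A = dim_col B \<Longrightarrow> A + (- A + B) = B"
  "dim_row A = dim_row B \<Longrightarrow> dim_col A = dim_col B \<Longrightarrow> - A + (A + B) = B"
  by (intro eq_matI; auto)+

lemma mat_neutral:
  "dim_row A = n \<Longrightarrow> 1\<^sub>m n * A = A" "dim_col A = n \<Longrightarrow> A * 1\<^sub>m n = A"
  "dim_row A = n \<Longrightarrow> 0\<^sub>m m n * A = 0\<^sub>m m (dim_col A)" "dim_col A = n \<Longrightarrow> A * 0\<^sub>m n m = 0\<^sub>m (dim_row A) m"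
  "dim_row A = m \<Longrightarrow> dim_col A = n \<Longrightarrow> 0\<^sub>m m n + A = A"
  "dim_row A = m \<Longrightarrow> dim_col A = n \<Longrightarrow> A + 0\<^sub>m m n = (A :: 'a::comm_ring_1 mat)"
  "- 0\<^sub>m m n = (0\<^sub>m m n :: 'a mat)"
  by (intro eq_matI; auto)+

lemmas mat_ring_simps = mat_assoc mat_distrib_left mat_distrib_right mat_diff mat_uminus_add
  mat_add_assoc mat_add_commute mat_add_left_commute mat_cancel mat_neutral

lemma append_cols_carrier [simp]:
  "A \<in> carrier_mat m a \<Longrightarrow> B \<in> carrier_mat m b \<Longrightarrow> append_cols A B \<in> carrier_mat m (a + b)"
  by (auto simp: append_cols_def)

lemma append_cols_mult_append_rows:
  fixes A :: "'a::comm_ring_1 mat"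
  assumes A: "A \<in> carrier_mat m a" and B: "B \<in> carrier_mat m b"
    and X: "X \<in> carrier_mat a n" and Y: "Y \<in> carrier_mat b n"
  shows "append_cols A B * (X @\<^sub>r Y) = A * X + B * Y"
proof -
  have "append_cols A B * (X @\<^sub>r Y) = four_block_mat A B (0\<^sub>m 0 a) (0\<^sub>m 0 b) * four_block_mat X (0\<^sub>m a 0) Y (0\<^sub>m b 0)"
    using assms by (simp add: append_cols_def append_rows_def)
  also have "\<dots> = four_block_mat (A * X + B * Y) (A * 0\<^sub>m a 0 + B * 0\<^sub>m b 0)
      (0\<^sub>m 0 a * X + 0\<^sub>m 0 b * Y) (0\<^sub>m 0 a * 0\<^sub>m a 0 + 0\<^sub>m 0 b * 0\<^sub>m b 0)"
    using assms by (intro mult_four_block_mat) auto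
  also have "\<dots> = A * X + B * Y"
    using assms by (intro eq_matI) auto
  finally show ?thesis .
qed

lemma append_rows_mult_append_cols:
  fixes A :: "'a::comm_ring_1 mat"
  assumes A: "A \<in> carrier_mat a n" and B: "B \<in> carrier_mat b n"
    and X: "X \<in> carrier_mat n c" and Y: "Y \<in> carrier_mat n d"
  shows "(A @\<^sub>r B) * append_cols X Y = four_block_mat (A * X) (A * Y) (B * X) (B * Y)"
proof -
  have "(A @\<^sub>r B) * append_cols X Y =
      four_block_mat A (0\<^sub>m a 0) B (0\<^sub>m b 0) * four_block_mat X Y (0\<^sub>m 0 c) (0\<^sub>m 0 d)"
    using assms by (simp add: append_cols_def append_rows_def)
  also have "\<dots> = four_block_mat (A * X + 0\<^sub>m a 0 * 0\<^sub>m 0 c) (A * Y + 0\<^sub>m a 0 * 0\<^sub>m 0 d)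
      (B * X + 0\<^sub>m b 0 * 0\<^sub>m 0 c) (B * Y + 0\<^sub>m b 0 * 0\<^sub>m 0 d)"
    using assms by (intro mult_four_block_mat) auto
  also have "\<dots> = four_block_mat (A * X) (A * Y) (B * X) (B * Y)"
    using assms by (intro cong_four_block_mat eq_matI) auto
  finally show ?thesis .
qed

lemma mult_append_cols:
  fixes A :: "'a::comm_ring_1 mat"
  assumes "A \<in> carrier_mat m n" "X \<in> carrier_mat n a" "Y \<in> carrier_mat n b"
  shows "A * append_cols X Y = append_cols (A * X) (A * Y)"
  using assms by (intro eq_matI) (auto simp: append_cols_def scalar_prod_def)

lemma append_rows_cases:
  fixes Z :: "'a::zero mat"
  assumes "Z \<in> carrier_mat (a + b) n"
  obtains X Y where "X \<in> carrier_mat a n" "Y \<in> carrier_mat b n" "Z = X @\<^sub>r Y"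
proof
  show "Z = mat a n (\<lambda>(i, j). Z $$ (i, j)) @\<^sub>r mat b n (\<lambda>(i, j). Z $$ (a + i, j))"
    using assms by (intro eq_matI) (auto simp: append_rows_def)
qed auto

lemma append_cols_cases:
  fixes Z :: "'a::zero mat"
  assumes "Z \<in> carrier_mat n (a + b)"
  obtains X Y where "X \<in> carrier_mat n a" "Y \<in> carrier_mat n b" "Z = append_cols X Y"
proof
  show "Z = append_cols (mat n a (\<lambda>(i, j). Z $$ (i, j))) (mat n b (\<lambda>(i, j). Z $$ (i, a + j)))"
    using assms by (intro eq_matI) (auto simp: append_cols_def)
qed auto

lemma mat_inverse_eqI:
  fixes A :: "'a::field mat"
  assumes A: "A \<in> carrier_mat n n" and Y: "Y \<in> carrier_mat n n" and inv: "A * Y = 1\<^sub>m n"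
  shows "the (mat_inverse A) = Y"
proof (cases "mat_inverse A")
  case None
  have "Y * A = 1\<^sub>m n" by (rule mat_mult_left_right_inverse[OF A Y inv])
  then have "A \<in> Units (ring_mat TYPE('a) n ())"
    using A Y inv by (auto simp: Units_def ring_mat_def)
  with mat_inverse(1)[OF A None, where b = "()"] show ?thesis by blast
next
  case (Some X)
  then have X: "X * A = 1\<^sub>m n" "X \<in> carrier_mat n n" using mat_inverse(2)[OF A] by auto
  have "X = X * (A * Y)" using X inv by simp
  also have "\<dots> = Y" using X A Y by (simp flip: assoc_mult_mat[OF X(2) A Y])
  finally show ?thesis using Some by simp
qed

lemma regular_inverse:
  assumes A: "A \<in> carrier_mat n n" and "regular A"
  shows "the (mat_inverse A) \<in> carrier_mat n n" "A * the (mat_inverse A) = 1\<^sub>m n"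
    "the (mat_inverse A) * A = 1\<^sub>m n"
proof -
  have "A \<in> Units (ring_mat TYPE('a poly fract) n ())"
    using det_non_zero_imp_unit[OF A] assms(2) by (auto simp: regular_def)
  then obtain X where "mat_inverse A = Some X" using mat_inverse(1)[OF A, where b = "()"] by (cases "mat_inverse A") auto
  then show "the (mat_inverse A) \<in> carrier_mat n n" "A * the (mat_inverse A) = 1\<^sub>m n"
    "the (mat_inverse A) * A = 1\<^sub>m n"
    using mat_inverse(2)[OF A] by auto
qed

lemma regular_if_inverse:
  assumes A: "A \<in> carrier_mat n n" and Y: "Y \<in> carrier_mat n n" and inv: "A * Y = 1\<^sub>m n"
  shows "regular A"
  using det_mult[OF A Y] inv A by (auto simp: regular_def)

section \<open>Splitting along dual bases\<close>

text \<open>The equation \<open>T = E + F (N T)\<close> says that \<open>T\<close> can be recovered from \<open>N T\<close> up to a defined matrix, but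
\<open>F\<close> need not be a right inverse of \<open>N\<close>.  Correcting it by a right inverse \<open>H0\<close> of \<open>N\<close> to
\<open>H = F + H0 (I - N F)\<close> achieves \<open>N H = I\<close> and leaves the defined remainder
\<open>T - H (N T) = E - H0 (N E)\<close>.  Since \<open>N\<close> annihilates \<open>K\<^sup>T\<close>, which has a left inverse \<open>S\<close>, the matrix
\<open>(H, K\<^sup>T)\<close> is square with inverse \<open>(N; J)\<close> for \<open>J = S (I - H N)\<close>.\<close>
lemma splitting_with_defined_remainder:
  fixes T :: "'a::field rmat"
  assumes T: "T \<in> carrier_mat p m"
    and N: "N \<in> carrier_mat q p" and rank_N: "full_row_rank_at x N"
    and K: "K \<in> carrier_mat k p" and rank_K: "full_row_rank_at x K"
    and qk: "q + k = p" and NK: "N * transpose_mat K = 0\<^sub>m q k"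
    and T_eq: "T = E + F * (N * T)" and E: "E \<in> carrier_mat p m" and F: "F \<in> carrier_mat p q"
    and d: "defined_at x E" "defined_at x F"
  obtains H J where "H \<in> carrier_mat p q" "J \<in> carrier_mat k p" "defined_at x H" "defined_at x J"
    "N * H = 1\<^sub>m q" "H * N + transpose_mat K * J = 1\<^sub>m p" "defined_at x (T - H * (N * T))"
proof -
  obtain H0 where N': "H0 \<in> carrier_mat p q" "N * H0 = 1\<^sub>m q" and dH0: "defined_at x H0"
    using full_row_rank_at_right_inverse[OF rank_N N] by metis
  obtain S' where S': "S' \<in> carrier_mat p k" "K * S' = 1\<^sub>m k" and dS': "defined_at x S'"
    using full_row_rank_at_right_inverse[OF rank_K K] by metis
  define K' where "K' = transpose_mat K"
  define S where "S = transpose_mat S'"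
  have S: "S \<in> carrier_mat k p" "S * K' = 1\<^sub>m k" "defined_at x S"
    using S' dS' transpose_mult[OF K S'(1)] by (simp_all add: S_def K'_def)
  have K': "K' \<in> carrier_mat p k" using K by (simp add: K'_def)
  note NK = NK[folded K'_def]
  have dN: "defined_at x N" using rank_N by (simp add: full_row_rank_at_def)
  note dims = carrier_matD[OF T] carrier_matD[OF N] carrier_matD[OF K'] carrier_matD[OF N'(1)]
    carrier_matD[OF S(1)] carrier_matD[OF E] carrier_matD[OF F]
  define H where "H = F + H0 * (1\<^sub>m q - N * F)"
  define J where "J = S * (1\<^sub>m p - H * N)"
  have H: "H \<in> carrier_mat p q" and J: "J \<in> carrier_mat k p"
    using N F N' S by (auto simp: H_def J_def)
  have dNF: "defined_at x (N * F)" by (rule mat_at_mult(1)[OF dN d(2) N F])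
  have "defined_at x (1\<^sub>m q - N * F)"
    using N F by (intro defined_at_minus[of _ _ _ q q] dNF) auto
  then have "defined_at x (H0 * (1\<^sub>m q - N * F))"
    using N F N' by (intro mat_at_mult(1)[OF dH0, of _ p q q]) auto
  then have dH: "defined_at x H"
    unfolding H_def using N F N' d by (intro defined_at_add[of _ _ _ p q]) auto
  have "defined_at x (H * N)" by (rule mat_at_mult(1)[OF dH dN H N])
  then have "defined_at x (1\<^sub>m p - H * N)"
    using H N by (intro defined_at_minus[of _ _ _ p p]) auto
  then have dJ: "defined_at x J"
    unfolding J_def using H N S by (intro mat_at_mult(1)[OF S(3), of _ k p p]) auto
  have NH: "N * H = 1\<^sub>m q"
  proof -
    have "N * H = N * F + (N * H0) * (1\<^sub>m q - N * F)"
      unfolding H_def by (simp add: dims mat_ring_simps)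
    also have "\<dots> = 1\<^sub>m q" unfolding N'(2) by (simp add: dims mat_ring_simps)
    finally show ?thesis .
  qed
  have "J * H = S * (H - H * (N * H))" "J * K' = S * (K' - H * (N * K'))"
    unfolding J_def using H by (simp_all add: dims mat_ring_simps)
  then have JH: "J * H = 0\<^sub>m k q" and JK: "J * K' = 1\<^sub>m k"
    using H S(2) by (simp_all add: NH NK dims mat_ring_simps)
  have "(N @\<^sub>r J) * append_cols H K' = 1\<^sub>m p"
    using qk by (simp add: append_rows_mult_append_cols[OF N J H K'] NH NK JH JK)
  then have "append_cols H K' * (N @\<^sub>r J) = 1\<^sub>m p"
    using mat_mult_left_right_inverse[of "N @\<^sub>r J" p "append_cols H K'"]
      carrier_append_rows[OF N J] append_cols_carrier[OF H K'] qk by simp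
  then have HNKJ: "H * N + K' * J = 1\<^sub>m p"
    by (simp add: append_cols_mult_append_rows[OF H K' N J])
  define Z where "Z = N * T"
  have Z: "dim_row Z = q" "dim_col Z = m" using dims by (auto simp: Z_def)
  have TZ: "T = E + F * Z" using T_eq by (simp add: Z_def)
  have ZE: "Z = N * E + N * (F * Z)"
    using arg_cong[OF TZ, of "\<lambda>M. N * M"] by (simp add: Z_def[symmetric] dims Z mat_ring_simps)
  have "Z - N * (F * Z) = N * E + N * (F * Z) - N * (F * Z)" using ZE by simp
  also have "\<dots> = N * E" by (simp add: dims Z mat_ring_simps)
  finally have ZNE: "Z - N * (F * Z) = N * E" .
  have "H * Z = F * Z + H0 * (Z - N * (F * Z))"
    unfolding H_def by (simp add: dims Z mat_ring_simps)
  then have "T - H * Z = E - H0 * (N * E)"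
    unfolding ZNE TZ by (simp add: dims Z mat_ring_simps)
  moreover have "defined_at x (E - H0 * (N * E))"
    using N E N' d dN dH0 by (intro defined_at_minus[of _ _ _ p m] mat_at_mult(1)[of _ H0 _ p q m]
        mat_at_mult(1)[of _ N _ q p m]) auto
  ultimately have "defined_at x (T - H * (N * T))" by (simp add: Z_def)
  then show thesis using that[OF H J dH dJ NH HNKJ[unfolded K'_def]] by blast
qed

text \<open>The elimination step.  Here \<open>K2\<close>, \<open>N1\<close> and \<open>J1\<close> play the role of \<open>K\<^sub>2\<^sup>T\<close>, \<open>N\<^sub>1\<^sup>T\<close> and of a
transposed complement.  A decomposition of \<open>W\<close> along the two splittings is a product
\<open>R1 diag(R, I) R2\<close> in which \<open>R1\<close> has the block rows \<open>(H2, K2, P)\<close> and \<open>(0, 0, I)\<close>, and \<open>R2\<close> has the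
block rows \<open>(H1, 0)\<close>, \<open>(Q, I)\<close> and \<open>(K1, 0)\<close>.  Their inverses can be written down from those of
\<open>(H2, K2)\<close> and \<open>(H1; K1)\<close>.\<close>
lemma block_equivalence_of_splittings:
  fixes H2 N2 K2 J2 H1 N1 K1 J1 R W :: "'a::field rmat"
  assumes H2: "H2 \<in> carrier_mat p q2" and N2: "N2 \<in> carrier_mat q2 p" and K2: "K2 \<in> carrier_mat p k2"
    and J2: "J2 \<in> carrier_mat k2 p" and I2: "H2 * N2 + K2 * J2 = 1\<^sub>m p" and qk2: "q2 + k2 = p"
    and H1: "H1 \<in> carrier_mat q1 m" and N1: "N1 \<in> carrier_mat m q1" and K1: "K1 \<in> carrier_mat k1 m"
    and J1: "J1 \<in> carrier_mat m k1" and I1: "N1 * H1 + J1 * K1 = 1\<^sub>m m" and qk1: "q1 + k1 = m"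
    and R: "R \<in> carrier_mat q2 q1" and P: "P \<in> carrier_mat p k1" and Q: "Q \<in> carrier_mat k2 m"
    and W: "W = H2 * R * H1 + K2 * Q + P * K1"
    and d: "defined_at x H2" "defined_at x N2" "defined_at x K2" "defined_at x J2"
      "defined_at x H1" "defined_at x N1" "defined_at x K1" "defined_at x J1"
      "defined_at x P" "defined_at x Q"
  obtains R1 R2 where
    "R1 \<in> carrier_mat (q2 + (k2 + k1)) (q2 + (k2 + k1))" "invertible_at x R1"
    "R2 \<in> carrier_mat (q1 + (k2 + k1)) (q1 + (k2 + k1))" "invertible_at x R2"
    "R1 * four_block_mat R (0\<^sub>m q2 (k2 + k1)) (0\<^sub>m (k2 + k1) q1) (1\<^sub>m (k2 + k1)) * R2 =
      four_block_mat W K2 K1 (0\<^sub>m k1 k2)"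
proof -
  note dims = carrier_matD[OF H2] carrier_matD[OF N2] carrier_matD[OF K2] carrier_matD[OF J2]
    carrier_matD[OF H1] carrier_matD[OF N1] carrier_matD[OF K1] carrier_matD[OF J1]
    carrier_matD[OF R] carrier_matD[OF P] carrier_matD[OF Q]
  note cs = H2 N2 K2 J2 H1 N1 K1 J1 R P Q
  define k where "k = k2 + k1"
  define KP where "KP = append_cols K2 P"
  define e1 where "e1 = append_cols (0\<^sub>m k1 k2) (1\<^sub>m k1 :: 'a rmat)"
  define QK where "QK = Q @\<^sub>r K1"
  define e2 where "e2 = 1\<^sub>m k2 @\<^sub>r (0\<^sub>m k1 k2 :: 'a rmat)"
  have c: "KP \<in> carrier_mat p k" "e1 \<in> carrier_mat k1 k" "QK \<in> carrier_mat k m" "e2 \<in> carrier_mat k k2"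
    using cs by (auto simp: KP_def e1_def QK_def e2_def k_def)
  have dc: "defined_at x KP" "defined_at x e1" "defined_at x QK" "defined_at x e2"
    unfolding KP_def e1_def QK_def e2_def
    by (rule defined_at_append_cols[OF d(3,9) K2 P] defined_at_append_rows[OF d(10,7) Q K1]
      defined_at_append_cols[OF defined_at_zero defined_at_one zero_carrier_mat one_carrier_mat]
      defined_at_append_rows[OF defined_at_one defined_at_zero one_carrier_mat zero_carrier_mat])+
  \<comment> \<open>The block rows and columns that belong to \<open>k2\<close> and \<open>k1\<close> are packed together, so that two by two
    block multiplication applies.  \<open>S1\<close> and \<open>S2\<close> are the inverses of \<open>R1\<close> and \<open>R2\<close>.\<close>
  define R1 where "R1 = four_block_mat H2 KP (0\<^sub>m k1 q2) e1"
  define R2 where "R2 = four_block_mat H1 (0\<^sub>m q1 k2) QK e2"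
  define S1 where "S1 = four_block_mat N2 (- (N2 * P)) (J2 @\<^sub>r 0\<^sub>m k1 p) (- (J2 * P) @\<^sub>r 1\<^sub>m k1)"
  define S2 where "S2 = four_block_mat N1 (append_cols (0\<^sub>m m k2) J1)
    (- (Q * N1)) (append_cols (1\<^sub>m k2) (- (Q * J1)))"
  have sz: "p + k1 = q2 + k" "m + k2 = q1 + k" "p + k1 = q2 + (k2 + k1)" "m + k2 = q1 + (k2 + k1)"
    using qk1 qk2 by (auto simp: k_def)
  have R1: "R1 \<in> carrier_mat (p + k1) (q2 + k)" and R2: "R2 \<in> carrier_mat (q1 + k) (m + k2)"
    using H2 c H1 by (auto simp: R1_def R2_def)
  have S1: "S1 \<in> carrier_mat (q2 + k) (p + k1)" and S2: "S2 \<in> carrier_mat (m + k2) (q1 + k)"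
    using cs c by (auto simp: S1_def S2_def k_def)
  have dR: "defined_at x R1" "defined_at x R2"
    unfolding R1_def R2_def using d dc c H1 H2
    by (auto intro!: defined_at_four_block)
  have dNP: "defined_at x (N2 * P)" "defined_at x (J2 * P)" "defined_at x (Q * N1)" "defined_at x (Q * J1)"
    by (rule mat_at_mult(1)[OF d(2,9) N2 P] mat_at_mult(1)[OF d(4,9) J2 P]
        mat_at_mult(1)[OF d(10,6) Q N1] mat_at_mult(1)[OF d(10,8) Q J1])+
  have dS1: "defined_at x S1"
    unfolding S1_def k_def
  proof (rule defined_at_four_block[of x _ _ _ _ q2 p k1 "k2 + k1"])
    show "defined_at x (J2 @\<^sub>r 0\<^sub>m k1 p)"
      by (rule defined_at_append_rows[OF d(4) defined_at_zero J2 zero_carrier_mat])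
    show "defined_at x (- (J2 * P) @\<^sub>r 1\<^sub>m k1)"
      using J2 P by (intro defined_at_append_rows[OF defined_at_uminus[OF dNP(2)] defined_at_one]) auto
  qed (use cs d(2) dNP(1) in \<open>auto simp: defined_at_uminus\<close>)
  have dS2: "defined_at x S2"
    unfolding S2_def k_def
  proof (rule defined_at_four_block[of x _ _ _ _ m q1 "k2 + k1" k2])
    show "defined_at x (append_cols (0\<^sub>m m k2) J1)"
      by (rule defined_at_append_cols[OF defined_at_zero d(8) zero_carrier_mat J1])
    show "defined_at x (append_cols (1\<^sub>m k2) (- (Q * J1)))"
      using Q J1 by (intro defined_at_append_cols[OF defined_at_one defined_at_uminus[OF dNP(4)]]) auto
  qed (use cs d(6) dNP(3) in \<open>auto simp: defined_at_uminus\<close>)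
  have b1: "KP * (J2 @\<^sub>r 0\<^sub>m k1 p) = K2 * J2" "KP * (- (J2 * P) @\<^sub>r 1\<^sub>m k1) = - (K2 * (J2 * P)) + P"
    "e1 * (J2 @\<^sub>r 0\<^sub>m k1 p) = 0\<^sub>m k1 p" "e1 * (- (J2 * P) @\<^sub>r 1\<^sub>m k1) = 1\<^sub>m k1"
    unfolding KP_def e1_def using cs
    by (simp_all add: append_cols_mult_append_rows[of _ p k2 _ k1 _ p] append_cols_mult_append_rows[of _ p k2 _ k1 _ k1]
      append_cols_mult_append_rows[of _ k1 k2 _ k1 _ p] append_cols_mult_append_rows[of _ k1 k2 _ k1 _ k1] dims mat_ring_simps)
  have HN: "H2 * (N2 * P) + K2 * (J2 * P) = P"
    using arg_cong[OF I2, of "\<lambda>M. M * P"] by (simp add: dims mat_ring_simps)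
  have "R1 * S1 = four_block_mat (H2 * N2 + KP * (J2 @\<^sub>r 0\<^sub>m k1 p))
    (H2 * - (N2 * P) + KP * (- (J2 * P) @\<^sub>r 1\<^sub>m k1))
    (0\<^sub>m k1 q2 * N2 + e1 * (J2 @\<^sub>r 0\<^sub>m k1 p))
    (0\<^sub>m k1 q2 * - (N2 * P) + e1 * (- (J2 * P) @\<^sub>r 1\<^sub>m k1))"
    unfolding R1_def S1_def using cs c
    by (intro mult_four_block_mat[of _ p q2 _ k _ k1 _ _ p _ k1]) (auto simp: k_def)
  also have "\<dots> = four_block_mat (1\<^sub>m p) (- (H2 * (N2 * P) + K2 * (J2 * P)) + P) (0\<^sub>m k1 p) (1\<^sub>m k1)"
    unfolding b1 I2 by (intro cong_four_block_mat) (simp_all add: dims mat_ring_simps)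
  also have "\<dots> = 1\<^sub>m (p + k1)" unfolding HN by (simp add: dims mat_ring_simps)
  finally have RS1: "R1 * S1 = 1\<^sub>m (q2 + k)" by (simp add: sz)
  have b2: "append_cols (0\<^sub>m m k2) J1 * QK = J1 * K1" "append_cols (0\<^sub>m m k2) J1 * e2 = 0\<^sub>m m k2"
    "append_cols (1\<^sub>m k2) (- (Q * J1)) * QK = Q + - (Q * (J1 * K1))" "append_cols (1\<^sub>m k2) (- (Q * J1)) * e2 = 1\<^sub>m k2"
    unfolding QK_def e2_def using cs
    by (simp_all add: append_cols_mult_append_rows[of _ m k2 _ k1 _ m] append_cols_mult_append_rows[of _ m k2 _ k1 _ k2]
      append_cols_mult_append_rows[of _ k2 k2 _ k1 _ m] append_cols_mult_append_rows[of _ k2 k2 _ k1 _ k2] dims mat_ring_simps)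
  have QN: "Q * (N1 * H1) + Q * (J1 * K1) = Q"
    using arg_cong[OF I1, of "\<lambda>M. Q * M"] by (simp add: dims mat_ring_simps)
  have "S2 * R2 = four_block_mat (N1 * H1 + append_cols (0\<^sub>m m k2) J1 * QK)
    (N1 * 0\<^sub>m q1 k2 + append_cols (0\<^sub>m m k2) J1 * e2)
    (- (Q * N1) * H1 + append_cols (1\<^sub>m k2) (- (Q * J1)) * QK)
    (- (Q * N1) * 0\<^sub>m q1 k2 + append_cols (1\<^sub>m k2) (- (Q * J1)) * e2)"
    unfolding R2_def S2_def using cs c
    by (intro mult_four_block_mat[of _ m q1 _ k _ k2 _ _ m _ k2]) (auto simp: k_def)
  also have "\<dots> = four_block_mat (1\<^sub>m m) (0\<^sub>m m k2) (Q + - (Q * (N1 * H1) + Q * (J1 * K1))) (1\<^sub>m k2)"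
    unfolding b2 I1 by (intro cong_four_block_mat) (simp_all add: dims mat_ring_simps)
  also have "\<dots> = 1\<^sub>m (m + k2)" unfolding QN by (simp add: dims mat_ring_simps)
  finally have RS2: "S2 * R2 = 1\<^sub>m (q1 + k)" by (simp add: sz)
  let ?D = "four_block_mat R (0\<^sub>m q2 k) (0\<^sub>m k q1) (1\<^sub>m k)"
  have "R1 * ?D = four_block_mat (H2 * R + KP * 0\<^sub>m k q1) (H2 * 0\<^sub>m q2 k + KP * 1\<^sub>m k)
      (0\<^sub>m k1 q2 * R + e1 * 0\<^sub>m k q1) (0\<^sub>m k1 q2 * 0\<^sub>m q2 k + e1 * 1\<^sub>m k)"
    unfolding R1_def using cs c
    by (intro mult_four_block_mat[of _ p q2 _ k _ k1 _ _ q1 _ k]) auto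
  also have "\<dots> = four_block_mat (H2 * R) KP (0\<^sub>m k1 q1) e1"
    using c by (intro cong_four_block_mat) (simp_all add: dims mat_ring_simps)
  finally have "R1 * ?D * R2 = four_block_mat (H2 * R) KP (0\<^sub>m k1 q1) e1 * R2" by simp
  also have "\<dots> = four_block_mat (H2 * R * H1 + KP * QK) (H2 * R * 0\<^sub>m q1 k2 + KP * e2)
      (0\<^sub>m k1 q1 * H1 + e1 * QK) (0\<^sub>m k1 q1 * 0\<^sub>m q1 k2 + e1 * e2)"
    unfolding R2_def using cs c
    by (intro mult_four_block_mat[of _ p q1 _ k _ k1 _ _ m _ k2]) auto
  also have "\<dots> = four_block_mat W K2 K1 (0\<^sub>m k1 k2)"
    unfolding W KP_def e1_def QK_def e2_def using cs
    by (intro cong_four_block_mat)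
      (simp_all add: append_cols_mult_append_rows[of _ p k2 _ k1 _ m] append_cols_mult_append_rows[of _ p k2 _ k1 _ k2]
      append_cols_mult_append_rows[of _ k1 k2 _ k1 _ m] append_cols_mult_append_rows[of _ k1 k2 _ k1 _ k2] dims mat_ring_simps)
  finally have "R1 * ?D * R2 = four_block_mat W K2 K1 (0\<^sub>m k1 k2)" .
  moreover have "invertible_at x R1"
    using invertible_at_if_inverse(1)[OF _ dR(1) _ dS1 RS1] R1 S1 by (simp add: sz(1))
  moreover have "invertible_at x R2"
    using invertible_at_if_inverse(2)[OF _ dS2 _ dR(2) RS2] R2 S2 by (simp add: sz(2))
  ultimately show thesis using that[of R1 R2] R1 R2 by (simp add: sz k_def)
qed

text \<open>The assumptions on \<open>T\<close> make it recoverable, up to defined matrices, both from \<open>N2 T\<close> and from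
\<open>T N1\<^sup>T\<close>.  With the two splittings that this provides, the remainder of \<open>W = M + T\<close> after
\<open>H2 R H1\<close> is defined at the point, and it vanishes between \<open>N2\<close> and \<open>N1\<^sup>T\<close>.  Expanding it along
both splittings therefore leaves only terms with a factor \<open>K2\<^sup>T\<close> on the left or \<open>K1\<close> on the right.\<close>
lemma block_full_rank_equivalence:
  fixes M T N1 N2 K1 K2 :: "'a::field rmat"
  assumes M: "M \<in> carrier_mat p m" and T: "T \<in> carrier_mat p m"
    and N2: "N2 \<in> carrier_mat q2 p" "full_row_rank_at x N2"
    and K2: "K2 \<in> carrier_mat k2 p" "full_row_rank_at x K2"
    and N1: "N1 \<in> carrier_mat q1 m" "full_row_rank_at x N1"
    and K1: "K1 \<in> carrier_mat k1 m" "full_row_rank_at x K1"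
    and qk: "q2 + k2 = p" "q1 + k1 = m"
    and dual: "N2 * transpose_mat K2 = 0\<^sub>m q2 k2" "N1 * transpose_mat K1 = 0\<^sub>m q1 k1"
    and dM: "defined_at x M"
    and T2: "T = E2 + F2 * (N2 * T)" "E2 \<in> carrier_mat p m" "F2 \<in> carrier_mat p q2"
      "defined_at x E2" "defined_at x F2"
    and T1: "T = E1 + T * transpose_mat N1 * F1" "E1 \<in> carrier_mat p m" "F1 \<in> carrier_mat q1 m"
      "defined_at x E1" "defined_at x F1"
  obtains R1 R2 where
    "R1 \<in> carrier_mat (q2 + (k2 + k1)) (q2 + (k2 + k1))" "invertible_at x R1"
    "R2 \<in> carrier_mat (q1 + (k2 + k1)) (q1 + (k2 + k1))" "invertible_at x R2"
    "R1 * four_block_mat (N2 * (M + T) * transpose_mat N1) (0\<^sub>m q2 (k2 + k1)) (0\<^sub>m (k2 + k1) q1) (1\<^sub>m (k2 + k1)) * R2 =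
      four_block_mat (M + T) (transpose_mat K2) K1 (0\<^sub>m k1 k2)"
proof -
  obtain H2 J2 where H2: "H2 \<in> carrier_mat p q2" "J2 \<in> carrier_mat k2 p" "defined_at x H2" "defined_at x J2"
      "N2 * H2 = 1\<^sub>m q2" "H2 * N2 + transpose_mat K2 * J2 = 1\<^sub>m p" "defined_at x (T - H2 * (N2 * T))"
    using splitting_with_defined_remainder[OF T N2 K2 qk(1) dual(1) T2] .
  have T1t: "transpose_mat T = transpose_mat E1 + transpose_mat F1 * (N1 * transpose_mat T)"
  proof -
    have "transpose_mat (T * transpose_mat N1 * F1) = transpose_mat F1 * (N1 * transpose_mat T)"
      using T T1(3) N1(1) transpose_mult[of "T * transpose_mat N1" p q1 F1 m]
        transpose_mult[of T p m "transpose_mat N1" q1] by simp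
    moreover have "transpose_mat T = transpose_mat E1 + transpose_mat (T * transpose_mat N1 * F1)"
      using T N1(1) T1(2,3) by (subst T1(1), subst transpose_add) auto
    ultimately show ?thesis by simp
  qed
  obtain H1 J1 where H1: "H1 \<in> carrier_mat m q1" "J1 \<in> carrier_mat k1 m" "defined_at x H1" "defined_at x J1"
      "N1 * H1 = 1\<^sub>m q1" "H1 * N1 + transpose_mat K1 * J1 = 1\<^sub>m m"
      "defined_at x (transpose_mat T - H1 * (N1 * transpose_mat T))"
    using splitting_with_defined_remainder[OF _ N1 K1 qk(2) dual(2) T1t] T T1(2-5) by auto
  define n1 where "n1 = transpose_mat N1"
  define h1 where "h1 = transpose_mat H1"
  define j1 where "j1 = transpose_mat J1"
  define l2 where "l2 = transpose_mat K2"
  have c: "n1 \<in> carrier_mat m q1" "h1 \<in> carrier_mat q1 m" "j1 \<in> carrier_mat m k1" "l2 \<in> carrier_mat p k2"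
    using N1 H1 K2 by (auto simp: n1_def h1_def j1_def l2_def)
  have hn1: "h1 * n1 = 1\<^sub>m q1"
    using transpose_mult[OF N1(1) H1(1)] H1(5) by (simp add: h1_def n1_def)
  have nh1: "n1 * h1 + j1 * K1 = 1\<^sub>m m"
  proof -
    have "transpose_mat (H1 * N1 + transpose_mat K1 * J1) = n1 * h1 + j1 * K1"
      using transpose_add[of "H1 * N1" m m "transpose_mat K1 * J1"] transpose_mult[OF H1(1) N1(1)]
        transpose_mult[of "transpose_mat K1" m k1 J1 m] H1(1,2) N1 K1 by (simp add: h1_def n1_def j1_def)
    then show ?thesis using H1(6) by simp
  qed
  have dT1: "defined_at x (T - T * (n1 * h1))"
  proof -
    have "transpose_mat (H1 * (N1 * transpose_mat T)) = T * (n1 * h1)"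
      using transpose_mult[of H1 m q1 "N1 * transpose_mat T" p] transpose_mult[of N1 q1 m "transpose_mat T" p]
        H1 N1 T by (simp add: n1_def h1_def assoc_mult_mat[of _ p m _ q1 _ m])
    then have "transpose_mat (transpose_mat T - H1 * (N1 * transpose_mat T)) = T - T * (n1 * h1)"
      using T H1 N1 by (subst transpose_minus[of _ m p]) auto
    then show ?thesis using H1(7) by (metis defined_at_transpose)
  qed
  define R where "R = N2 * (M + T) * n1"
  define \<Delta> where "\<Delta> = M + T - H2 * R * h1"
  note dims = carrier_matD[OF M] carrier_matD[OF T] carrier_matD[OF N2(1)] carrier_matD[OF K1(1)]
    carrier_matD[OF H2(1)] carrier_matD[OF H2(2)] carrier_matD[OF c(1)] carrier_matD[OF c(2)]
    carrier_matD[OF c(3)] carrier_matD[OF c(4)]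
  have R: "R \<in> carrier_mat q2 q1" and \<Delta>: "\<Delta> \<in> carrier_mat p m"
    using M T N2 c H2 by (auto simp: R_def \<Delta>_def)
  have d: "defined_at x N2" "defined_at x l2" "defined_at x n1" "defined_at x K1" "defined_at x h1" "defined_at x j1"
    using N2 K2 N1 K1 H1 by (auto simp: full_row_rank_at_def l2_def n1_def h1_def j1_def)
  \<comment> \<open>Compress first on the left and then on the right; each compression changes \<open>T\<close> by a defined
    matrix only.\<close>
  have d\<Delta>: "defined_at x \<Delta>"
  proof -
    have "\<Delta> = M - H2 * (N2 * (M * (n1 * h1))) + (T - H2 * (N2 * T)) + H2 * (N2 * (T - T * (n1 * h1)))"
      unfolding \<Delta>_def R_def by (simp add: dims mat_ring_simps)
    moreover have "defined_at x (M - H2 * (N2 * (M * (n1 * h1))))"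
      using M N2 c H2 d dM
      by (intro defined_at_minus[of _ _ _ p m] mat_at_mult(1)[of _ H2 _ p q2 m] mat_at_mult(1)[of _ N2 _ q2 p m]
          mat_at_mult(1)[of _ M _ p m m] mat_at_mult(1)[of _ n1 _ m q1 m]) auto
    moreover have "defined_at x (H2 * (N2 * (T - T * (n1 * h1))))"
      using T N2 c H2 d dT1
      by (intro mat_at_mult(1)[of _ H2 _ p q2 m] mat_at_mult(1)[of _ N2 _ q2 p m]) auto
    ultimately show ?thesis
      using M T N2 c H2 by (auto intro!: defined_at_add[of _ _ _ p m])
  qed
  have z: "N2 * (\<Delta> * n1) = 0\<^sub>m q2 q1"
  proof -
    have "N2 * (\<Delta> * n1) = R - (N2 * H2) * (R * (h1 * n1))"
      unfolding \<Delta>_def R_def by (simp add: dims mat_ring_simps)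
    also have "\<dots> = 0\<^sub>m q2 q1" unfolding H2(5) hn1 using R by (simp add: mat_ring_simps)
    finally show ?thesis .
  qed
  define Q where "Q = J2 * \<Delta>"
  define P where "P = H2 * (N2 * (\<Delta> * j1))"
  have PQ: "P \<in> carrier_mat p k1" "Q \<in> carrier_mat k2 m" "defined_at x P" "defined_at x Q"
    using H2 N2 c \<Delta> d d\<Delta>
    by (auto simp: P_def Q_def intro!: mat_at_mult(1)[of _ H2 _ p q2 k1] mat_at_mult(1)[of _ N2 _ q2 p k1]
          mat_at_mult(1)[of _ \<Delta> _ p m k1] mat_at_mult(1)[of _ J2 _ k2 p m])
  \<comment> \<open>Of the terms of the expansion only the one with \<open>N2 * (\<Delta> * n1)\<close> is not of the desired form.\<close>
  have "\<Delta> = l2 * Q + P * K1"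
  proof -
    have "\<Delta> = (H2 * N2 + l2 * J2) * \<Delta> * (n1 * h1 + j1 * K1)"
      using H2(6) nh1 \<Delta> by (simp add: l2_def)
    also have "\<dots> = H2 * (N2 * (\<Delta> * n1)) * h1 + P * K1 + l2 * Q * (n1 * h1 + j1 * K1)"
      unfolding P_def Q_def by (simp add: dims carrier_matD[OF \<Delta>] mat_ring_simps)
    also have "\<dots> = l2 * Q + P * K1"
      unfolding z nh1 using PQ by (simp add: dims mat_ring_simps)
    finally show ?thesis .
  qed
  moreover have "M + T = H2 * R * h1 + \<Delta>"
    unfolding \<Delta>_def R_def by (simp add: dims mat_ring_simps)
  ultimately have W: "M + T = H2 * R * h1 + l2 * Q + P * K1"
    using PQ R by (simp add: dims mat_ring_simps)
  show thesis
    using block_equivalence_of_splittings[OF H2(1) N2(1) c(4) H2(2) _ qk(1) c(2,1) K1(1) c(3) nh1 qk(2) R PQ(1,2) W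
        H2(3) d(1,2) H2(4) d(5,3,4,6) PQ(3,4)] H2(6) that
    unfolding R_def l2_def n1_def by blast
qed

section \<open>Linearization at a finite point\<close>

text \<open>A left inverse \<open>(U, V)\<close> of the smaller block column yields the left inverse \<open>(U, - V N, 0)\<close> of the
larger one.  Together with its counterpart for columns this turns the rank conditions into
minimality of the system matrix, in which \<open>C\<close> is padded by zero rows and \<open>B\<close> by zero columns.\<close>
lemma rank_append_rows_of_product:
  fixes A :: "'a::field mat"
  assumes A: "A \<in> carrier_mat n n" and C: "C \<in> carrier_mat p n" and N: "N \<in> carrier_mat q p"
    and rank: "mat_rank (A @\<^sub>r - (N * C)) = n"
  shows "mat_rank (A @\<^sub>r (C @\<^sub>r 0\<^sub>m k n)) = n"
proof -
  have c: "A @\<^sub>r - (N * C) \<in> carrier_mat (n + q) n" "A @\<^sub>r (C @\<^sub>r 0\<^sub>m k n) \<in> carrier_mat (n + (p + k)) n"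
    using A N C by auto
  obtain Z where Z: "Z \<in> carrier_mat n (n + q)" "Z * (A @\<^sub>r - (N * C)) = 1\<^sub>m n"
    using rank mat_rank_eq_dim_col_iff[OF c(1)] by blast
  obtain U V where UV: "U \<in> carrier_mat n n" "V \<in> carrier_mat n q" "Z = append_cols U V"
    using append_cols_cases[OF Z(1)] .
  note dims = carrier_matD[OF A] carrier_matD[OF C] carrier_matD[OF N]
    carrier_matD[OF UV(1)] carrier_matD[OF UV(2)]
  have VN: "- (V * N) \<in> carrier_mat n p" using UV(2) N by simp
  define W where "W = append_cols (- (V * N)) (0\<^sub>m n k)"
  have W: "W \<in> carrier_mat n (p + k)" using VN by (simp add: W_def)
  have "W * (C @\<^sub>r 0\<^sub>m k n) = - (V * N) * C"
    unfolding W_def append_cols_mult_append_rows[OF VN zero_carrier_mat C zero_carrier_mat]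
    by (simp add: dims mat_ring_simps)
  then have "append_cols U W * (A @\<^sub>r (C @\<^sub>r 0\<^sub>m k n)) = U * A + V * - (N * C)"
    using append_cols_mult_append_rows[OF UV(1) W A, of "C @\<^sub>r 0\<^sub>m k n"] C
    by (simp add: dims mat_ring_simps)
  also have "\<dots> = 1\<^sub>m n"
    using Z(2) append_cols_mult_append_rows[OF UV(1,2) A, of "- (N * C)"] N C by (simp add: UV(3))
  finally show ?thesis
    using mat_rank_eq_dim_col_iff[OF c(2)] append_cols_carrier[OF UV(1) W] by blast
qed

lemma rank_append_cols_of_product:
  fixes A :: "'a::field mat"
  assumes A: "A \<in> carrier_mat n n" and B: "B \<in> carrier_mat n m" and N: "N \<in> carrier_mat m q"
    and rank: "mat_rank (append_cols A (B * N)) = n"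
  shows "mat_rank (append_cols A (append_cols B (0\<^sub>m n k))) = n"
proof -
  have BN: "B * N \<in> carrier_mat n q" using B N by simp
  have c: "append_cols A (B * N) \<in> carrier_mat n (n + q)"
    "append_cols A (append_cols B (0\<^sub>m n k)) \<in> carrier_mat n (n + (m + k))"
    using A B BN by auto
  obtain Z where Z: "Z \<in> carrier_mat (n + q) n" "append_cols A (B * N) * Z = 1\<^sub>m n"
    using rank mat_rank_eq_dim_row_iff[OF c(1)] by blast
  obtain U V where UV: "U \<in> carrier_mat n n" "V \<in> carrier_mat q n" "Z = U @\<^sub>r V"
    using append_rows_cases[OF Z(1)] .
  note dims = carrier_matD[OF A] carrier_matD[OF B] carrier_matD[OF N]
    carrier_matD[OF UV(1)] carrier_matD[OF UV(2)]
  have NV: "N * V \<in> carrier_mat m n" using UV(2) N by simp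
  define W where "W = (N * V) @\<^sub>r 0\<^sub>m k n"
  have W: "W \<in> carrier_mat (m + k) n" using NV by (simp add: W_def)
  have "append_cols B (0\<^sub>m n k) * W = B * (N * V)"
    unfolding W_def append_cols_mult_append_rows[OF B zero_carrier_mat NV zero_carrier_mat]
    by (simp add: dims mat_ring_simps)
  then have "append_cols A (append_cols B (0\<^sub>m n k)) * (U @\<^sub>r W) = A * U + B * N * V"
    using append_cols_mult_append_rows[OF A _ UV(1) W, of "append_cols B (0\<^sub>m n k)"] B
    by (simp add: dims mat_ring_simps)
  also have "\<dots> = 1\<^sub>m n"
    using Z(2) append_cols_mult_append_rows[OF A BN UV(1,2)] by (simp add: UV(3))
  finally show ?thesis
    using mat_rank_eq_dim_row_iff[OF c(2)] carrier_append_rows[OF UV(1) W] by blast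
qed

text \<open>The rank condition says that the value at \<open>x\<close> of the block column of \<open>A\<close> and \<open>- N C\<close> has a left
inverse; the two blocks of a lifted left inverse are the Bezout coefficients.\<close>
lemma left_bezout_at:
  fixes A :: "'a::field rmat"
  assumes A: "A \<in> carrier_mat n n" and C: "C \<in> carrier_mat p n" and N: "N \<in> carrier_mat q p"
    and d: "defined_at x A" "defined_at x C" "defined_at x N"
    and rank: "mat_rank (mat_value x A @\<^sub>r - (mat_value x N * mat_value x C)) = n"
  obtains X V where "X \<in> carrier_mat n n" "V \<in> carrier_mat n q" "X * A + V * (N * C) = 1\<^sub>m n"
    "defined_at x X" "defined_at x V"
proof -
  note NC = mat_at_mult[OF d(3,2) N C]
  have NCc: "- (N * C) \<in> carrier_mat q n" using N C by simp
  have G: "A @\<^sub>r - (N * C) \<in> carrier_mat (n + q) n" "defined_at x (A @\<^sub>r - (N * C))"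
    using A NCc defined_at_append_rows[OF d(1) defined_at_uminus[OF NC(1)] A NCc] by auto
  have vG: "mat_value x (A @\<^sub>r - (N * C)) = mat_value x A @\<^sub>r - (mat_value x N * mat_value x C)"
    using mat_value_append_rows[OF A NCc] mat_value_uminus[OF NC(1)] NC(2) by simp
  have vGc: "mat_value x (A @\<^sub>r - (N * C)) \<in> carrier_mat (n + q) n" using G by simp
  obtain Z where Z: "Z \<in> carrier_mat n (n + q)" "Z * mat_value x (A @\<^sub>r - (N * C)) = 1\<^sub>m n"
    using rank mat_rank_eq_dim_col_iff[OF vGc] by (auto simp: vG)
  obtain S where S: "S \<in> carrier_mat n (n + q)" "defined_at x S" "S * (A @\<^sub>r - (N * C)) = 1\<^sub>m n"
    using defined_at_left_inverse[OF G Z] .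
  obtain X V where XV: "X \<in> carrier_mat n n" "V \<in> carrier_mat n q" "S = append_cols X V"
    using append_cols_cases[OF S(1)] .
  have dXV: "defined_at x X" "defined_at x V"
    using defined_at_append_colsD[OF S(2)[unfolded XV(3)] XV(1,2)] .
  have "X * A + - V * (N * C) = 1\<^sub>m n"
    using S(3) append_cols_mult_append_rows[OF XV(1,2) A NCc] XV(1,2) N C by (simp add: XV(3))
  then show thesis
    using that[of X "- V"] XV dXV by (simp add: defined_at_uminus)
qed

lemma right_bezout_at:
  fixes A :: "'a::field rmat"
  assumes A: "A \<in> carrier_mat n n" and B: "B \<in> carrier_mat n m" and N: "N \<in> carrier_mat m q"
    and d: "defined_at x A" "defined_at x B" "defined_at x N"
    and rank: "mat_rank (append_cols (mat_value x A) (mat_value x B * mat_value x N)) = n"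
  obtains X V where "X \<in> carrier_mat n n" "V \<in> carrier_mat q n" "A * X + B * N * V = 1\<^sub>m n"
    "defined_at x X" "defined_at x V"
proof -
  note BN = mat_at_mult[OF d(2,3) B N]
  have BNc: "B * N \<in> carrier_mat n q" using B N by simp
  have G: "append_cols A (B * N) \<in> carrier_mat n (n + q)" "defined_at x (append_cols A (B * N))"
    using A BNc defined_at_append_cols[OF d(1) BN(1) A BNc] by auto
  have vG: "mat_value x (append_cols A (B * N)) = append_cols (mat_value x A) (mat_value x B * mat_value x N)"
    using mat_value_append_cols[OF A BNc] BN(2) by simp
  have vGc: "mat_value x (append_cols A (B * N)) \<in> carrier_mat n (n + q)" using G by simp
  obtain Z where Z: "Z \<in> carrier_mat (n + q) n" "mat_value x (append_cols A (B * N)) * Z = 1\<^sub>m n"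
    using rank mat_rank_eq_dim_row_iff[OF vGc] by (auto simp: vG)
  obtain S where S: "S \<in> carrier_mat (n + q) n" "defined_at x S" "append_cols A (B * N) * S = 1\<^sub>m n"
    using defined_at_right_inverse[OF G Z] .
  obtain X V where XV: "X \<in> carrier_mat n n" "V \<in> carrier_mat q n" "S = X @\<^sub>r V"
    using append_rows_cases[OF S(1)] .
  have dXV: "defined_at x X" "defined_at x V"
    using defined_at_append_rowsD[OF S(2)[unfolded XV(3)] XV(1,2)] .
  have "A * X + B * N * V = 1\<^sub>m n"
    using S(3) append_cols_mult_append_rows[OF A BNc XV(1,2)] by (simp add: XV(3))
  then show thesis using that[of X V] XV dXV by simp
qed

text \<open>The counterpart at a finite point of the theorem at infinity.  The two Bezout identities are what
makes \<open>C A\<^sup>-\<^sup>1 B\<close> recoverable from both of its compressions; for \<open>N2 = I\<close> and \<open>N1 = I\<close> they would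
express ordinary minimality of the system matrix.\<close>
lemma linearization_at_block_full_rank:
  fixes A B C M K1 K2 N1 N2 P L :: "'a::field rmat"
  assumes A: "A \<in> carrier_mat n n" and B: "B \<in> carrier_mat n m" and C: "C \<in> carrier_mat p n"
    and M: "M \<in> carrier_mat p m"
    and K1: "K1 \<in> carrier_mat k1 m" "full_row_rank_at x K1"
    and K2: "K2 \<in> carrier_mat k2 p" "full_row_rank_at x K2"
    and N1: "N1 \<in> carrier_mat q1 m" "full_row_rank_at x N1"
    and N2: "N2 \<in> carrier_mat q2 p" "full_row_rank_at x N2"
    and qk: "q1 + k1 = m" "q2 + k2 = p"
    and dual: "N1 * transpose_mat K1 = 0\<^sub>m q1 k1" "N2 * transpose_mat K2 = 0\<^sub>m q2 k2"
    and L_def: "L = four_block_mat M (transpose_mat K2) K1 (0\<^sub>m k1 k2)"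
    and P_def: "P = four_block_mat A (append_cols B (0\<^sub>m n k2)) (- (C @\<^sub>r 0\<^sub>m k1 n)) L"
    and pencil: "pencil P" and reg: "regular A"
    and rank_col: "mat_rank (mat_value x A @\<^sub>r - (mat_value x N2 * mat_value x C)) = n"
    and rank_row: "mat_rank (append_cols (mat_value x A)
      (mat_value x B * transpose_mat (mat_value x N1))) = n"
  shows "linearization_at x (N2 * (M + C * the (mat_inverse A) * B) * transpose_mat N1) P A"
proof -
  define B' where "B' = append_cols B (0\<^sub>m n k2)"
  define C' where "C' = C @\<^sub>r 0\<^sub>m k1 n"
  define Y where "Y = the (mat_inverse A)"
  define T where "T = C * Y * B"
  note inv = regular_inverse[OF A reg, folded Y_def]
  have L: "L \<in> carrier_mat (p + k1) (m + k2)" using M by (simp add: L_def)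
  have B': "B' \<in> carrier_mat n (m + k2)" and C': "C' \<in> carrier_mat (p + k1) n"
    using B C by (auto simp: B'_def C'_def)
  have T: "T \<in> carrier_mat p m" using C inv B by (auto simp: T_def)
  note P = P_def[folded B'_def C'_def]
  have dP: "defined_at x A" "defined_at x B'" "defined_at x (- C')" "defined_at x L"
    using defined_at_four_blockD[OF defined_at_pencil[OF pencil, unfolded P] A B' _ L] C' by auto
  have d: "defined_at x N1" "defined_at x N2" using N1 N2 by (auto simp: full_row_rank_at_def)
  have dB: "defined_at x B" by (rule defined_at_append_colsD(1)[OF dP(2)[unfolded B'_def] B zero_carrier_mat])
  have dC: "defined_at x C"
    using defined_at_append_rowsD(1)[of x C _ p n k1] defined_at_uminus[OF dP(3)] C by (auto simp: C'_def)
  have dM: "defined_at x M"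
    using defined_at_four_blockD(1)[OF dP(4)[unfolded L_def] M _ K1(1), of k2] K2 by auto
  have "polynomial_matrix P" using pencil by (auto simp: pencil_def polynomial_matrix_def)
  then have sys: "polynomial_system_matrix P A B' C' L"
    using A B' C' L reg P by (auto simp: polynomial_system_matrix_def)

  note vals = A[folded mat_value_carrier[of x]] B[folded mat_value_carrier[of x]]
    C[folded mat_value_carrier[of x]] N1(1)[folded mat_value_carrier[of x]] N2(1)[folded mat_value_carrier[of x]]
  have min: "minimal_at x A B' C'"
    using rank_append_rows_of_product[OF vals(1,3,5) rank_col, of k1]
      rank_append_cols_of_product[OF vals(1,2) _ rank_row, of q1 k2] vals(4) A
    unfolding minimal_at_def B'_def C'_def mat_value_append_rows[OF C zero_carrier_mat]
      mat_value_append_cols[OF B zero_carrier_mat] mat_value_zero by simp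
  obtain X2 V2 where XV2: "X2 \<in> carrier_mat n n" "V2 \<in> carrier_mat n q2" "X2 * A + V2 * (N2 * C) = 1\<^sub>m n"
    and dXV2: "defined_at x X2" "defined_at x V2"
    using left_bezout_at[OF A C N2(1) dP(1) dC d(2) rank_col] .
  obtain X1 V1 where XV1: "X1 \<in> carrier_mat n n" "V1 \<in> carrier_mat q1 n"
      "A * X1 + B * transpose_mat N1 * V1 = 1\<^sub>m n"
    and dXV1: "defined_at x X1" "defined_at x V1"
    using right_bezout_at[OF A B, of "transpose_mat N1" q1 x] N1(1) dP(1) dB d(1) rank_row by auto

  note dims = carrier_matD[OF A] carrier_matD[OF B] carrier_matD[OF C] carrier_matD[OF inv(1)]
    carrier_matD[OF N1(1)] carrier_matD[OF N2(1)] carrier_matD[OF XV1(1)] carrier_matD[OF XV1(2)]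
    carrier_matD[OF XV2(1)] carrier_matD[OF XV2(2)]
  \<comment> \<open>Insert the Bezout identities into \<open>C A\<^sup>-\<^sup>1 B\<close>, next to \<open>C\<close> and next to \<open>B\<close>.\<close>
  define E2 where "E2 = C * (X2 * B)"
  define F2 where "F2 = C * V2"
  have T2: "T = E2 + F2 * (N2 * T)"
  proof -
    have "T = C * ((X2 * A + V2 * (N2 * C)) * (Y * B))"
      unfolding XV2(3) T_def by (simp add: dims mat_ring_simps)
    also have "\<dots> = C * (X2 * ((A * Y) * B)) + F2 * (N2 * T)"
      unfolding F2_def T_def by (simp add: dims mat_ring_simps)
    finally show ?thesis unfolding inv(2) E2_def using B by simp
  qed
  define E1 where "E1 = C * (X1 * B)"
  define F1 where "F1 = V1 * B"
  have T1: "T = E1 + T * transpose_mat N1 * F1"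
  proof -
    have "T = C * (Y * ((A * X1 + B * transpose_mat N1 * V1) * B))"
      unfolding XV1(3) T_def by (simp add: dims mat_ring_simps)
    also have "\<dots> = C * ((Y * A) * (X1 * B)) + T * transpose_mat N1 * F1"
      unfolding F1_def T_def by (simp add: dims mat_ring_simps)
    finally show ?thesis unfolding inv(3) E1_def using XV1 B by simp
  qed
  have cEF: "E1 \<in> carrier_mat p m" "F1 \<in> carrier_mat q1 m" "E2 \<in> carrier_mat p m" "F2 \<in> carrier_mat p q2"
    using B C XV1 XV2 by (auto simp: E1_def F1_def E2_def F2_def)
  have XB: "X1 * B \<in> carrier_mat n m" "X2 * B \<in> carrier_mat n m" using XV1 XV2 B by auto
  have dXB: "defined_at x (X1 * B)" "defined_at x (X2 * B)"
    using mat_at_mult(1)[OF dXV1(1) dB XV1(1) B] mat_at_mult(1)[OF dXV2(1) dB XV2(1) B] .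
  have dEF: "defined_at x E1" "defined_at x F1" "defined_at x E2" "defined_at x F2"
    unfolding E1_def F1_def E2_def F2_def
    using mat_at_mult(1)[OF dC dXB(1) C XB(1)] mat_at_mult(1)[OF dXV1(2) dB XV1(2) B]
      mat_at_mult(1)[OF dC dXB(2) C XB(2)] mat_at_mult(1)[OF dC dXV2(2) C XV2(2)] .
  obtain R1 R2 where R:
    "R1 \<in> carrier_mat (q2 + (k2 + k1)) (q2 + (k2 + k1))" "invertible_at x R1"
    "R2 \<in> carrier_mat (q1 + (k2 + k1)) (q1 + (k2 + k1))" "invertible_at x R2"
    "R1 * four_block_mat (N2 * (M + T) * transpose_mat N1) (0\<^sub>m q2 (k2 + k1)) (0\<^sub>m (k2 + k1) q1) (1\<^sub>m (k2 + k1)) * R2 =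
      four_block_mat (M + T) (transpose_mat K2) K1 (0\<^sub>m k1 k2)"
    using block_full_rank_equivalence[OF M T N2 K2 N1 K1 qk(2,1) dual(2,1) dM T2 cEF(3,4) dEF(3,4) T1 cEF(1,2) dEF(1,2)] .

  have tf: "transfer_function A B' C' L = four_block_mat (M + T) (transpose_mat K2) K1 (0\<^sub>m k1 k2)"
  proof -
    have YB: "Y * B' = append_cols (Y * B) (0\<^sub>m n k2)"
      unfolding B'_def using B inv(1) by (subst mult_append_cols[OF inv(1) B]) auto
    have "C' * Y * B' = C' * (Y * B')" by (rule assoc_mult_mat[OF C' inv(1) B'])
    also have "\<dots> = four_block_mat T (0\<^sub>m p k2) (0\<^sub>m k1 m) (0\<^sub>m k1 k2)"
      unfolding YB C'_def T_def using B C inv(1)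
      by (subst append_rows_mult_append_cols[OF C, of _ k1 _ m _ k2]) (auto simp: dims mat_ring_simps)
    finally have "transfer_function A B' C' L =
      four_block_mat M (transpose_mat K2) K1 (0\<^sub>m k1 k2) + four_block_mat T (0\<^sub>m p k2) (0\<^sub>m k1 m) (0\<^sub>m k1 k2)"
      by (simp add: transfer_function_def Y_def L_def)
    also have "\<dots> = four_block_mat (M + T) (transpose_mat K2) K1 (0\<^sub>m k1 k2)"
      using M T K1 K2 by (subst add_four_block_mat[of _ p m _ k2 _ k1]) auto
    finally show ?thesis .
  qed
  define R where "R = N2 * (M + C * the (mat_inverse A) * B) * transpose_mat N1"
  have R_eq: "R = N2 * (M + T) * transpose_mat N1" by (simp add: R_def T_def Y_def)
  have Rc: "R \<in> carrier_mat q2 q1" using N1 N2 M T by (auto simp: R_eq)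
  have diag: "diag_block_mat [H, 1\<^sub>m s] = four_block_mat H (0\<^sub>m (dim_row H) s) (0\<^sub>m s (dim_col H)) (1\<^sub>m s)"
    for H :: "'a rmat" and s
    by (subst diag_block_mat.simps) (simp add: Let_def del: diag_block_mat.simps)
  have diag0: "diag_block_mat [H, 1\<^sub>m 0] = H" for H :: "'a rmat"
    unfolding diag by (intro eq_matI) auto
  have "R1 * diag_block_mat [R, 1\<^sub>m (k2 + k1)] * R2 = diag_block_mat [transfer_function A B' C' L, 1\<^sub>m 0]"
    unfolding diag0 unfolding diag tf using R(5)[folded R_eq] carrier_matD[OF Rc] by simp
  moreover have "int (k2 + k1) - int 0 = int (dim_row L) - int (dim_row R)"
    "int (k2 + k1) - int 0 = int (dim_col L) - int (dim_col R)"
    using L Rc qk by auto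
  ultimately show ?thesis
    unfolding linearization_at_def R_def[symmetric] carrier_matD[OF Rc]
    using pencil sys min R(1-4) by blast
qed

section \<open>Reversals\<close>

lemma to_fract_const_add: "to_fract [:a + b:] = to_fract [:a::'a::field:] + to_fract [:b:]"
  by (simp flip: to_fract_add)

lemma poly_subst_pCons:
  "poly_subst (pCons a p) z = to_fract [:a::'a::field:] + z * poly_subst p z"
  by (cases "pCons a p = 0") (simp_all add: poly_subst_def map_poly_pCons)

lemma poly_subst_const [simp]: "poly_subst 0 z = 0" "poly_subst 1 z = 1"
  using poly_subst_pCons[of 1 0 z] by (simp_all add: poly_subst_def flip: one_pCons)

lemma poly_subst_add:
  "poly_subst (p + q) z = poly_subst p z + poly_subst (q :: 'a::field poly) z"
proof -
  have "map_poly (\<lambda>c. to_fract [:c:]) (p + q) =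
      map_poly (\<lambda>c. to_fract [:c:]) p + map_poly (\<lambda>c. to_fract [:c:]) q"
    by (intro poly_eqI) (simp add: coeff_map_poly to_fract_const_add)
  then show ?thesis by (simp add: poly_subst_def)
qed

lemma poly_subst_var: "poly_subst p var = to_fract (p :: 'a::field poly)"
proof (induction p)
  case (pCons a p)
  have "pCons a p = [:a:] + [:0, 1:] * p" by simp
  then have "to_fract (pCons a p) = to_fract [:a:] + var * to_fract p"
    unfolding var_def by (simp only: to_fract_add to_fract_mult)
  with pCons show ?case by (simp add: poly_subst_pCons)
qed simp

lemma var_nonzero [simp]: "var \<noteq> (0 :: 'a::field poly fract)"
  by (simp add: var_def)

text \<open>The element \<open>1/\<lambda>\<close> is transcendental over the constants: if it were a root of \<open>p\<close>, then \<open>\<lambda>\<close> would be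
a root of the reflected polynomial, but substituting \<open>\<lambda>\<close> into a polynomial changes nothing.  Hence
\<open>\<lambda> \<mapsto> 1/\<lambda>\<close> extends to fractions.\<close>
lemma poly_subst_inverse_var_nonzero:
  assumes "p \<noteq> (0 :: 'a::field poly)"
  shows "poly_subst p (1 / var) \<noteq> 0"
proof
  define P where "P = map_poly (\<lambda>c. to_fract [:c:]) p"
  assume "poly_subst p (1 / var) = 0"
  then have "poly P (inverse var) = 0" by (simp add: poly_subst_def P_def inverse_eq_divide)
  then have "poly (reflect_poly P) var = 0" by (simp add: poly_reflect_poly_nz)
  moreover have "reflect_poly P = map_poly (\<lambda>c. to_fract [:c:]) (reflect_poly p)"
  proof -
    have "degree P = degree p" unfolding P_def by (rule degree_map_poly) simp
    then show ?thesis
      by (intro poly_eqI) (simp add: coeff_reflect_poly coeff_map_poly P_def)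
  qed
  ultimately have "to_fract (reflect_poly p) = 0"
    using poly_subst_var[of "reflect_poly p"] by (simp add: poly_subst_def)
  with assms show False by simp
qed

text \<open>Reversal can be computed from any representing fraction, not only from the reduced one; the
algebraic laws of reversal then follow from those of polynomial substitution.\<close>
lemma rat_rev_Fract:
  assumes "d \<noteq> 0"
  shows "rat_rev g (Fract n d) = var powi g * (poly_subst n (1 / var) / poly_subst d (1 / var))"
proof -
  obtain k where k: "k \<noteq> 0" "n = k * num (Fract n d)" "d = k * den (Fract n d)"
    using assms by (metis num_den_Fract)
  have "poly_subst n (1 / var) / poly_subst d (1 / var) =
    (poly_subst k (1 / var) * poly_subst (num (Fract n d)) (1 / var)) /
    (poly_subst k (1 / var) * poly_subst (den (Fract n d)) (1 / var))"
    using k(2,3) by (metis poly_subst_mult)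
  then show ?thesis
    using poly_subst_inverse_var_nonzero[OF k(1)] by (simp add: rat_rev_def)
qed

lemma rat_rev_0 [simp]: "rat_rev g 0 = 0"
  using rat_rev_Fract[of 1 g 0] by (simp add: fract_collapse)

lemma rat_rev_1 [simp]: "rat_rev 0 1 = 1"
  using rat_rev_Fract[of 1 0 1] by (simp add: fract_collapse)

lemma rat_rev_add: "rat_rev g (r + s) = rat_rev g r + rat_rev g s"
proof -
  obtain a b where r: "r = Fract a b" "b \<noteq> 0" by (cases r) auto
  obtain c d where s: "s = Fract c d" "d \<noteq> 0" by (cases s) auto
  have "r + s = Fract (a * d + c * b) (b * d)" using r s by simp
  then show ?thesis
    using r s poly_subst_inverse_var_nonzero[of b] poly_subst_inverse_var_nonzero[of d]
    by (simp add: rat_rev_Fract poly_subst_add poly_subst_mult add_frac_eq algebra_simps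
        flip: add_divide_distrib)
qed

lemma rat_rev_mult: "rat_rev (g + h) (r * s) = rat_rev g r * rat_rev h s"
proof -
  obtain a b where r: "r = Fract a b" "b \<noteq> 0" by (cases r) auto
  obtain c d where s: "s = Fract c d" "d \<noteq> 0" by (cases s) auto
  have "r * s = Fract (a * c) (b * d)" using r s by simp
  then show ?thesis
    using r s by (simp add: rat_rev_Fract poly_subst_mult power_int_add)
qed

lemma rat_rev_uminus: "rat_rev g (- r) = - rat_rev g r"
  using rat_rev_add[of g r "- r"] by (simp add: eq_neg_iff_add_eq_0 add.commute)

lemma rat_rev_sum: "rat_rev g (sum f I) = (\<Sum>i\<in>I. rat_rev g (f i))"
  by (induction I rule: infinite_finite_induct) (simp_all add: rat_rev_add)

lemma mat_rev_carrier [simp]: "mat_rev g G \<in> carrier_mat m n \<longleftrightarrow> G \<in> carrier_mat m n"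
  by (simp add: mat_rev_def)

lemma mat_rev_mult:
  assumes "G \<in> carrier_mat m n" "H \<in> carrier_mat n l"
  shows "mat_rev (g + h) (G * H) = mat_rev g G * mat_rev h H"
  using assms
  by (intro eq_matI) (auto simp: mat_rev_def scalar_prod_def rat_rev_sum rat_rev_mult)

lemma mat_rev_add:
  assumes "G \<in> carrier_mat m n" "H \<in> carrier_mat m n"
  shows "mat_rev g (G + H) = mat_rev g G + mat_rev g H"
  using assms by (intro eq_matI) (auto simp: mat_rev_def rat_rev_add)

lemma mat_rev_simps [simp]:
  "mat_rev g (0\<^sub>m m n) = 0\<^sub>m m n" "mat_rev 0 (1\<^sub>m m) = 1\<^sub>m m"
  "mat_rev g (- G) = - mat_rev g G"
  "mat_rev g (transpose_mat G) = transpose_mat (mat_rev g G)"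
  by (intro eq_matI; auto simp: mat_rev_def rat_rev_uminus)+

lemma mat_rev_four_block:
  assumes "G \<in> carrier_mat m n" "H \<in> carrier_mat m k" "J \<in> carrier_mat l n" "K \<in> carrier_mat l k"
  shows "mat_rev g (four_block_mat G H J K) =
    four_block_mat (mat_rev g G) (mat_rev g H) (mat_rev g J) (mat_rev g K)"
  unfolding mat_rev_def by (rule map_four_block_mat[OF assms])

lemma mat_rev_append_cols:
  assumes "G \<in> carrier_mat m n" "H \<in> carrier_mat m k"
  shows "mat_rev g (append_cols G H) = append_cols (mat_rev g G) (mat_rev g H)"
  using assms mat_rev_four_block[of G m n H k "0\<^sub>m 0 n" 0 "0\<^sub>m 0 k" g]
  by (simp add: append_cols_def mat_rev_def[of _ G] mat_rev_def[of _ H])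

lemma mat_rev_append_rows:
  assumes "G \<in> carrier_mat m n" "H \<in> carrier_mat k n"
  shows "mat_rev g (G @\<^sub>r H) = mat_rev g G @\<^sub>r mat_rev g H"
  using assms mat_rev_four_block[of G m n "0\<^sub>m m 0" 0 H k "0\<^sub>m k 0" g]
  by (simp add: append_rows_def mat_rev_def[of _ G] mat_rev_def[of _ H])

lemma pencil_mat_rev:
  assumes "pencil G"
  shows "pencil (mat_rev 1 G)"
proof -
  have "rat_rev 1 r \<in> to_fract ` {p. degree p \<le> 1}" if r: "r \<in> to_fract ` {p. degree p \<le> 1}" for r :: "'a poly fract"
  proof -
    obtain p where p: "r = to_fract p" "degree p \<le> 1" using r by auto
    have "p = [:coeff p 0, coeff p 1:]"
      using p(2) by (intro poly_eqI) (auto simp: coeff_pCons coeff_eq_0 split: nat.split)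
    then have "rat_rev 1 r = to_fract [:coeff p 1, coeff p 0:]"
      using p(1) rat_rev_linear[of "coeff p 0" "coeff p 1"] by simp
    then show ?thesis by (intro image_eqI) auto
  qed
  then show ?thesis
    using assms unfolding pencil_def mat_rev_def elements_mat_map by blast
qed

section \<open>Linearization at infinity\<close>

theorem theorem3p10:
  fixes A B C M K\<^sub>1 K\<^sub>2 N\<^sub>1 N\<^sub>2 L \<L> :: "'a :: alg_closed_field poly fract mat"
    and n p\<^sub>0 m\<^sub>0 k\<^sub>1 k\<^sub>2 :: nat
    and t\<^sub>1 t\<^sub>2 :: int
  assumes n: "n > 0"
    and A: "A \<in> carrier_mat n n"
    and B: "B \<in> carrier_mat n m\<^sub>0"
    and C: "C \<in> carrier_mat p\<^sub>0 n"
    and M: "M \<in> carrier_mat p\<^sub>0 m\<^sub>0"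
    and K1: "K\<^sub>1 \<in> carrier_mat k\<^sub>1 m\<^sub>0"
    and K2: "K\<^sub>2 \<in> carrier_mat k\<^sub>2 p\<^sub>0"
    and L_def: "L = four_block_mat M (transpose_mat K\<^sub>2) K\<^sub>1 (0\<^sub>m k\<^sub>1 k\<^sub>2)"
    and LL_def: "\<L> = four_block_mat A (append_cols B (0\<^sub>m n k\<^sub>2)) (- C @\<^sub>r 0\<^sub>m k\<^sub>1 n) L"
    and system: "polynomial_system_matrix \<L> A (append_cols B (0\<^sub>m n k\<^sub>2)) (C @\<^sub>r 0\<^sub>m k\<^sub>1 n) L"
    and linear: "pencil \<L>"
    and nonconstant: "\<not> constant_matrix \<L>"
    and block_full_rank: "block_full_rank_pencil L M K\<^sub>1 K\<^sub>2"
    and dual1: "dual_rational_bases K\<^sub>1 N\<^sub>1"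
    and dual2: "dual_rational_bases K\<^sub>2 N\<^sub>2"
    and degrees1: "\<forall>i < dim_row N\<^sub>1. row_degree N\<^sub>1 i = Fin t\<^sub>1"
    and degrees2: "\<forall>i < dim_row N\<^sub>2. row_degree N\<^sub>2 i = Fin t\<^sub>2"
    and rev_K1: "full_row_rank_at 0 (mat_rev 1 K\<^sub>1)"
    and rev_K2: "full_row_rank_at 0 (mat_rev 1 K\<^sub>2)"
    and rev_N1: "full_row_rank_at 0 (mat_rev t\<^sub>1 N\<^sub>1)"
    and rev_N2: "full_row_rank_at 0 (mat_rev t\<^sub>2 N\<^sub>2)"
    and rank_col: "mat_rank (mat_value 0 (mat_rev 1 A) @\<^sub>r
                    - (mat_value 0 (mat_rev t\<^sub>2 N\<^sub>2) * mat_value 0 (mat_rev 1 C))) = n"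
    and rank_row: "mat_rank (append_cols (mat_value 0 (mat_rev 1 A))
                    (mat_value 0 (mat_rev 1 B) * transpose_mat (mat_value 0 (mat_rev t\<^sub>1 N\<^sub>1)))) = n"
  shows "linearization_at_infinity (1 + t\<^sub>1 + t\<^sub>2)
           (N\<^sub>2 * (M + C * the (mat_inverse A) * B) * transpose_mat N\<^sub>1) \<L> A"
proof -
  define Y where "Y = the (mat_inverse A)"
  have reg: "regular A" using system by (simp add: polynomial_system_matrix_def)
  note inv = regular_inverse[OF A reg, folded Y_def]
  define q\<^sub>1 where "q\<^sub>1 = dim_row N\<^sub>1"
  define q\<^sub>2 where "q\<^sub>2 = dim_row N\<^sub>2"
  have N1: "N\<^sub>1 \<in> carrier_mat q\<^sub>1 m\<^sub>0" "q\<^sub>1 + k\<^sub>1 = m\<^sub>0" "K\<^sub>1 * transpose_mat N\<^sub>1 = 0\<^sub>m k\<^sub>1 q\<^sub>1"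
    using dual1 K1 by (auto simp: dual_rational_bases_def q\<^sub>1_def)
  have N2: "N\<^sub>2 \<in> carrier_mat q\<^sub>2 p\<^sub>0" "q\<^sub>2 + k\<^sub>2 = p\<^sub>0" "K\<^sub>2 * transpose_mat N\<^sub>2 = 0\<^sub>m k\<^sub>2 q\<^sub>2"
    using dual2 K2 by (auto simp: dual_rational_bases_def q\<^sub>2_def)
  have rev_dual: "mat_rev t N * transpose_mat (mat_rev 1 K) = 0\<^sub>m q k"
    if "K \<in> carrier_mat k m" "N \<in> carrier_mat q m" "K * transpose_mat N = 0\<^sub>m k q"
    for K N :: "'a poly fract mat" and k q m t
  proof -
    have "N * transpose_mat K = 0\<^sub>m q k"
      using transpose_mult[of K k m "transpose_mat N" q] that by simp
    then show ?thesis
      using mat_rev_mult[of N q m "transpose_mat K" k t 1] that by simp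
  qed
  have rev_inv: "mat_rev 1 A * mat_rev (- 1) Y = 1\<^sub>m n"
    using mat_rev_mult[OF A inv(1), of 1 "- 1"] inv(2) by simp
  have rev_Y: "the (mat_inverse (mat_rev 1 A)) = mat_rev (- 1) Y"
    using mat_inverse_eqI[OF _ _ rev_inv] A inv(1) by simp
  have rev_reg: "regular (mat_rev 1 A)"
    using regular_if_inverse[OF _ _ rev_inv] A inv(1) by simp
  have L: "L \<in> carrier_mat (p\<^sub>0 + k\<^sub>1) (m\<^sub>0 + k\<^sub>2)" using M by (simp add: L_def)
  have rev_LL: "mat_rev 1 \<L> = four_block_mat (mat_rev 1 A) (append_cols (mat_rev 1 B) (0\<^sub>m n k\<^sub>2))
      (- (mat_rev 1 C @\<^sub>r 0\<^sub>m k\<^sub>1 n)) (mat_rev 1 L)"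
  proof -
    have "\<L> = four_block_mat A (append_cols B (0\<^sub>m n k\<^sub>2)) (- (C @\<^sub>r 0\<^sub>m k\<^sub>1 n)) L"
      using system by (simp add: polynomial_system_matrix_def)
    then show ?thesis
      using mat_rev_four_block[of A n n "append_cols B (0\<^sub>m n k\<^sub>2)" "m\<^sub>0 + k\<^sub>2" "- (C @\<^sub>r 0\<^sub>m k\<^sub>1 n)" "p\<^sub>0 + k\<^sub>1" L 1]
        A B C L mat_rev_append_cols[OF B zero_carrier_mat] mat_rev_append_rows[OF C zero_carrier_mat]
      by simp
  qed
  have rev_L: "mat_rev 1 L = four_block_mat (mat_rev 1 M) (transpose_mat (mat_rev 1 K\<^sub>2)) (mat_rev 1 K\<^sub>1) (0\<^sub>m k\<^sub>1 k\<^sub>2)"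
    unfolding L_def using M K1 K2 by (subst mat_rev_four_block[of _ p\<^sub>0 m\<^sub>0 _ k\<^sub>2 _ k\<^sub>1]) auto
  have rev_R: "mat_rev (1 + t\<^sub>1 + t\<^sub>2) (N\<^sub>2 * (M + C * Y * B) * transpose_mat N\<^sub>1) =
      mat_rev t\<^sub>2 N\<^sub>2 * (mat_rev 1 M + mat_rev 1 C * mat_rev (- 1) Y * mat_rev 1 B) *
      transpose_mat (mat_rev t\<^sub>1 N\<^sub>1)"
  proof -
    have CY: "C * Y \<in> carrier_mat p\<^sub>0 n" and T: "C * Y * B \<in> carrier_mat p\<^sub>0 m\<^sub>0"
      using C inv B by auto
    have "mat_rev 1 (C * Y * B) = mat_rev 1 C * mat_rev (- 1) Y * mat_rev 1 B"
      using mat_rev_mult[OF CY B, of 0 1] mat_rev_mult[OF C inv(1), of 1 "- 1"] by simp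
    then have W: "mat_rev 1 (M + C * Y * B) = mat_rev 1 M + mat_rev 1 C * mat_rev (- 1) Y * mat_rev 1 B"
      using mat_rev_add[OF M T] by simp
    have MT: "M + C * Y * B \<in> carrier_mat p\<^sub>0 m\<^sub>0" using M T by simp
    have "mat_rev (t\<^sub>2 + 1 + t\<^sub>1) (N\<^sub>2 * (M + C * Y * B) * transpose_mat N\<^sub>1) =
      mat_rev (t\<^sub>2 + 1) (N\<^sub>2 * (M + C * Y * B)) * mat_rev t\<^sub>1 (transpose_mat N\<^sub>1)"
      using mult_carrier_mat[OF N2(1) MT] N1(1) by (intro mat_rev_mult) auto
    also have "mat_rev (t\<^sub>2 + 1) (N\<^sub>2 * (M + C * Y * B)) = mat_rev t\<^sub>2 N\<^sub>2 * mat_rev 1 (M + C * Y * B)"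
      by (rule mat_rev_mult[OF N2(1) MT])
    finally show ?thesis unfolding W by (simp add: ac_simps)
  qed
  have "linearization_at 0
      (mat_rev t\<^sub>2 N\<^sub>2 * (mat_rev 1 M + mat_rev 1 C * the (mat_inverse (mat_rev 1 A)) * mat_rev 1 B) *
        transpose_mat (mat_rev t\<^sub>1 N\<^sub>1)) (mat_rev 1 \<L>) (mat_rev 1 A)"
  proof (rule linearization_at_block_full_rank[OF _ _ _ _ _ rev_K1 _ rev_K2 _ rev_N1 _ rev_N2
      N1(2) N2(2) rev_dual[OF K1 N1(1,3)] rev_dual[OF K2 N2(1,3)] rev_L rev_LL
      pencil_mat_rev[OF linear] rev_reg rank_col rank_row])
  qed (use A B C M K1 K2 N1(1) N2(1) in simp_all)
  then have "linearization_at 0 (mat_rev (1 + t\<^sub>1 + t\<^sub>2) (N\<^sub>2 * (M + C * Y * B) * transpose_mat N\<^sub>1))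
      (mat_rev 1 \<L>) (mat_rev 1 A)"
    unfolding rev_R rev_Y .
  then show ?thesis
    unfolding linearization_at_infinity_def Y_def using linear nonconstant system by blast
qed

end
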